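(* For every integer $n\ge 1$, the complex random variable $W_n=H_n/\sqrt{(2n-1)!!}$ has a radial, radially nonincreasing density $p_n$ on $\mathbb{C}$ (with respect to two-dimensional Lebesgue measure). Moreover, $$\lVert p_n\rVert_\infty=p_n(0)\le \frac1\pi B_n,\qquad B_n:=\frac{(2n-1)!!}{2^{n-1}(n-1)!}=\frac{2n}{4^n}\binom{2n}{n}.$$ Consequently, for every $z\in\mathbb{C}$ and every $\varepsilon>0$, $$\mathbb{P}\bigl(|W_n-z|\le\varepsilon\bigr)\le B_n\varepsilon^2\le 2\sqrt{\frac n\pi}\,\varepsilon^2 .$$
   Context: For a symmetric $2n\times 2n$ complex matrix $A=(a_{ij})$, the hafnian is $\operatorname{haf}(A)=\sum_{M}\prod_{\{i,j\}\in M}a_{ij}$, the sum being over all perfect matchings $M$ of $\{1,\dots,2n\}$ (partitions into $n$ unordered pairs); it does not depend on the diagonal entries. $\mathcal{CN}(0,1)$ denotes the standard circular complex Gaussian law: real and imaginary parts independent, centered, real Gaussian with variance $1/2$ each. $G_{2n}$ is a $2n\times 2n$ complex symmetric random matrix whose entries above the diagonal are independent $\mathcal{CN}(0,1)$ (the diagonal is arbitrary), and $H_n=\operatorname{haf}(G_{2n})$. Here $(2n-1)!!=1\cdot3\cdots(2n-1)$. *)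

theory Defs
  imports "HOL-Probability.Probability"
begin

definition perfect_matchings :: "'v set \<Rightarrow> 'v set set set" where
  "perfect_matchings V = {P. partition_on V P \<and> (\<forall>e\<in>P. card e = 2)}"

text \<open>
  Matrices of size \<open>2n\<close> are functions of two indices ranging over \<open>{1..2n}\<close>.
  An edge \<open>e = {i, j}\<close> of a matching is read off the matrix in increasing order of its
  endpoints; for symmetric matrices the order is irrelevant (lemma \<open>edge_entry\<close>).
\<close>

definition symmetric_matrix :: "nat \<Rightarrow> (nat \<Rightarrow> nat \<Rightarrow> 'a) \<Rightarrow> bool" where
  "symmetric_matrix N A \<longleftrightarrow> (\<forall>i\<in>{1..N}. \<forall>j\<in>{1..N}. A i j = A j i)"

definition hafnian :: "nat \<Rightarrow> (nat \<Rightarrow> nat \<Rightarrow> 'a::comm_semiring_1) \<Rightarrow> 'a" where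
  "hafnian n A = (\<Sum>P\<in>perfect_matchings {1..2 * n}. \<Prod>e\<in>P. A (Min e) (Max e))"

lemma edge_entry:
  assumes "symmetric_matrix N A" "i \<in> {1..N}" "j \<in> {1..N}"
  shows "A (Min {i, j}) (Max {i, j}) = A i j"
  using assms by (auto simp: symmetric_matrix_def min_def max_def)

text \<open>The second parameter of \<^const>\<open>normal_density\<close> is the standard deviation.\<close>

definition std_complex_normal :: "'a measure \<Rightarrow> ('a \<Rightarrow> complex) \<Rightarrow> bool" where
  "std_complex_normal M X \<longleftrightarrow>
     prob_space.indep_var M borel (\<lambda>\<omega>. Re (X \<omega>)) borel (\<lambda>\<omega>. Im (X \<omega>)) \<and>
     distributed M lborel (\<lambda>\<omega>. Re (X \<omega>)) (normal_density 0 (sqrt (1 / 2))) \<and>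
     distributed M lborel (\<lambda>\<omega>. Im (X \<omega>)) (normal_density 0 (sqrt (1 / 2)))"

text \<open>
  Nothing but measurability is required of the diagonal entries; in particular they need not be
  independent of the others.
\<close>

definition gaussian_symmetric_matrix ::
    "'a measure \<Rightarrow> nat \<Rightarrow> ('a \<Rightarrow> nat \<Rightarrow> nat \<Rightarrow> complex) \<Rightarrow> bool" where
  "gaussian_symmetric_matrix M N G \<longleftrightarrow>
     (\<forall>i\<in>{1..N}. \<forall>j\<in>{1..N}. (\<lambda>\<omega>. G \<omega> i j) \<in> borel_measurable M) \<and>
     (\<forall>\<omega>\<in>space M. symmetric_matrix N (G \<omega>)) \<and>
     prob_space.indep_vars M (\<lambda>_. borel) (\<lambda>(i, j) \<omega>. G \<omega> i j) {(i, j). 1 \<le> i \<and> i < j \<and> j \<le> N} \<and>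
     (\<forall>i j. 1 \<le> i \<and> i < j \<and> j \<le> N \<longrightarrow> std_complex_normal M (\<lambda>\<omega>. G \<omega> i j))"

text \<open>\<open>odd_double_fact n\<close> is \<open>(2n - 1)!! = 1 \<cdot> 3 \<cdots> (2n - 1)\<close>.\<close>

definition odd_double_fact :: "nat \<Rightarrow> nat" where
  "odd_double_fact n = (\<Prod>k=1..n. 2 * k - 1)"

definition normalized_hafnian :: "nat \<Rightarrow> (nat \<Rightarrow> nat \<Rightarrow> complex) \<Rightarrow> complex" where
  "normalized_hafnian n A = hafnian n A / complex_of_real (sqrt (real (odd_double_fact n)))"

definition B :: "nat \<Rightarrow> real" where
  "B n = real (odd_double_fact n) / (2 ^ (n - 1) * fact (n - 1))"

end

theory Submission
  imports Defs "HOL-Real_Asymp.Real_Asymp"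
begin

text \<open>
  Expanding the hafnian \<open>H\<^sub>n\<close> along its first row, whose entries \<open>x\<^sub>b\<close> are independent of the remaining
  matrix, gives \<open>H\<^sub>n = \<Sum>\<^sub>b x\<^sub>b h\<^sub>b\<close> with \<open>h\<^sub>b\<close> the hafnians of the minors of the remaining matrix. Given
  these, \<open>H\<^sub>n\<close> is a centered circular Gaussian of variance \<open>S\<^sub>n = \<Sum>\<^sub>b \<bar>h\<^sub>b\<bar>\<^sup>2\<close>, so its law is a mixture of
  radially decreasing densities with value \<open>E[1 / S\<^sub>n] / \<pi>\<close> at \<open>0\<close>. It remains to show
  \<open>E[1 / S\<^sub>n] \<le> 1 / (2\<^sup>n\<^sup>-\<^sup>1 (n - 1)!)\<close>, by induction on \<open>n\<close>.

  For a deterministic first row \<open>u\<close>, the characteristic function of \<open>\<Sum>\<^sub>b u\<^sub>b h\<^sub>b\<close> is dominated in modulus by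
  that of \<open>\<bar>u\<bar> h\<^sub>d\<close>, where \<open>h\<^sub>d\<close> has the law of \<open>H\<^sub>n\<^sub>-\<^sub>1\<close>. Indeed, if all rows but \<open>a\<close> and \<open>d\<close> are fixed, the
  conditional characteristic function is an oscillatory Gaussian integral whose modulus depends only on
  \<open>\<bar>u\<^sub>a\<bar>\<^sup>2 + \<bar>u\<^sub>d\<bar>\<^sup>2\<close> and which is nonnegative if \<open>u\<^sub>a = 0 \<le> u\<^sub>d\<close>, so the entries of \<open>u\<close> can be moved one by one into
  position \<open>d\<close>. Averaging over a Gaussian \<open>u\<close> yields \<open>E exp(- s S\<^sub>n) \<le> E exp(- s \<bar>x\<bar>\<^sup>2 S\<^sub>n\<^sub>-\<^sub>1)\<close> with \<open>x\<close> an
  independent Gaussian vector in \<open>2n - 1\<close> complex dimensions, and integrating over \<open>s > 0\<close> gives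
  \<open>E[1 / S\<^sub>n] \<le> E[1 / \<bar>x\<bar>\<^sup>2] E[1 / S\<^sub>n\<^sub>-\<^sub>1] = E[1 / S\<^sub>n\<^sub>-\<^sub>1] / (2n - 2)\<close>.
\<close>

section \<open>Complex Gaussian vectors\<close>

definition cgauss :: "complex measure" where
  "cgauss = density lborel (\<lambda>z. ennreal (exp (- (cmod z)\<^sup>2) / pi))"

lemma sets_cgauss [measurable_cong, simp]: "sets cgauss = sets borel"
  by (simp add: cgauss_def)

lemma space_cgauss [simp]: "space cgauss = UNIV"
  by (simp add: cgauss_def)

lemma measurable_Complex [measurable]:
  "(\<lambda>p. Complex (fst p) (snd p)) \<in> borel_measurable (borel \<Otimes>\<^sub>M borel)"
  unfolding Complex_eq by measurable

text \<open>Lebesgue measure is determined by its values on boxes, and a box in the plane is a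
  product of two intervals. This carries real product densities over to
  \<open>complex\<close>.\<close>

lemma lborel_complex_eq:
  "distr (lborel \<Otimes>\<^sub>M lborel) borel (\<lambda>p. Complex (fst p) (snd p)) = lborel"
proof (rule lborel_eqI[symmetric])
  fix l u :: complex
  assume le: "\<And>b. b \<in> Basis \<Longrightarrow> l \<bullet> b \<le> u \<bullet> b"
  have le': "Re l \<le> Re u" "Im l \<le> Im u"
    using le[of 1] le[of \<i>] by (auto simp: Basis_complex_def)
  have "emeasure (distr (lborel \<Otimes>\<^sub>M lborel) borel (\<lambda>p. Complex (fst p) (snd p))) (box l u)
      = emeasure (lborel \<Otimes>\<^sub>M lborel) ((\<lambda>p. Complex (fst p) (snd p)) -` box l u \<inter> space (lborel \<Otimes>\<^sub>M lborel))"
    by (rule emeasure_distr) auto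
  also have "(\<lambda>p. Complex (fst p) (snd p)) -` box l u \<inter> space (lborel \<Otimes>\<^sub>M lborel)
      = {Re l<..<Re u} \<times> {Im l<..<Im u}"
    by (auto simp: box_def Basis_complex_def space_pair_measure)
  also have "emeasure (lborel \<Otimes>\<^sub>M lborel) \<dots> = ennreal (Re u - Re l) * ennreal (Im u - Im l)"
    using le' by (subst lborel.emeasure_pair_measure_Times) auto
  also have "\<dots> = ennreal (\<Prod>b\<in>Basis. (u - l) \<bullet> b)"
    using le' by (simp add: Basis_complex_def ennreal_mult)
  finally show "emeasure (distr (lborel \<Otimes>\<^sub>M lborel) borel (\<lambda>p. Complex (fst p) (snd p))) (box l u)
      = ennreal (\<Prod>b\<in>Basis. (u - l) \<bullet> b)" .
qed simp

abbreviation half_normal :: "real measure" where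
  "half_normal \<equiv> density lborel (normal_density 0 (sqrt (1/2)))"

interpretation half_normal: prob_space half_normal
  by (rule prob_space_normal_density) simp

text \<open>Two centered real densities of variance 1/2 multiply to
  \<open>exp (- (cmod z)\<^sup>2) / pi\<close>, so the planar density agrees with the description by
  independent real and imaginary parts. It also gives \<open>cgauss\<close> total mass one.\<close>

lemma cgauss_eq_distr:
  "cgauss = distr (half_normal \<Otimes>\<^sub>M half_normal) borel (\<lambda>p. Complex (fst p) (snd p))"
proof -
  have "half_normal \<Otimes>\<^sub>M half_normal
      = density (lborel \<Otimes>\<^sub>M lborel) (\<lambda>(x, y). ennreal (normal_density 0 (sqrt (1/2)) x) * ennreal (normal_density 0 (sqrt (1/2)) y))"
    by (rule pair_measure_density) (auto intro: sigma_finite_lborel half_normal.sigma_finite_measure_axioms)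
  also have "(\<lambda>(x, y). ennreal (normal_density 0 (sqrt (1/2)) x) * ennreal (normal_density 0 (sqrt (1/2)) y))
     = (\<lambda>z. ennreal (exp (- (cmod z)\<^sup>2) / pi)) \<circ> (\<lambda>p. Complex (fst p) (snd p))"
    by (auto simp: fun_eq_iff normal_density_def ennreal_mult[symmetric] cmod_def exp_add[symmetric] field_simps)
  also have "density (lborel \<Otimes>\<^sub>M lborel) \<dots> =
     distr (density (distr (lborel \<Otimes>\<^sub>M lborel) borel (\<lambda>p. Complex (fst p) (snd p))) (\<lambda>z. ennreal (exp (- (cmod z)\<^sup>2) / pi)))
       (lborel \<Otimes>\<^sub>M lborel) (\<lambda>z. (Re z, Im z))"
    by (rule distr_density_distr[symmetric]) auto
  also have "\<dots> = distr cgauss (lborel \<Otimes>\<^sub>M lborel) (\<lambda>z. (Re z, Im z))"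
    unfolding lborel_complex_eq cgauss_def ..
  finally have *: "half_normal \<Otimes>\<^sub>M half_normal = distr cgauss (lborel \<Otimes>\<^sub>M lborel) (\<lambda>z. (Re z, Im z))" .
  show ?thesis
    unfolding * by (subst distr_distr) (auto simp: o_def distr_id2)
qed

interpretation cgauss: prob_space cgauss
proof -
  interpret p: prob_space "half_normal \<Otimes>\<^sub>M half_normal"
    by (intro prob_space_pair half_normal.prob_space_axioms)
  show "prob_space cgauss"
    unfolding cgauss_eq_distr by (rule p.prob_space_distr) simp
qed

lemma distr_eq_cgaussI:
  assumes "std_complex_normal M X" "prob_space M"
  shows "distr M borel X = cgauss"
proof -
  interpret prob_space M by fact
  have iv: "indep_var borel (\<lambda>\<omega>. Re (X \<omega>)) borel (\<lambda>\<omega>. Im (X \<omega>))"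
    and R: "distr M lborel (\<lambda>\<omega>. Re (X \<omega>)) = half_normal"
    and I: "distr M lborel (\<lambda>\<omega>. Im (X \<omega>)) = half_normal"
    using assms(1) by (auto simp: std_complex_normal_def distributed_def)
  have [measurable]: "(\<lambda>\<omega>. Re (X \<omega>)) \<in> borel_measurable M" "(\<lambda>\<omega>. Im (X \<omega>)) \<in> borel_measurable M"
    using iv by (auto dest: indep_var_rv1 indep_var_rv2)
  have "distr M borel (\<lambda>\<omega>. Re (X \<omega>)) = half_normal" "distr M borel (\<lambda>\<omega>. Im (X \<omega>)) = half_normal"
    using R I by (simp_all cong: distr_cong)
  then have "distr M (borel \<Otimes>\<^sub>M borel) (\<lambda>\<omega>. (Re (X \<omega>), Im (X \<omega>))) = half_normal \<Otimes>\<^sub>M half_normal"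
    using iv unfolding indep_var_distribution_eq by simp
  then have "cgauss = distr (distr M (borel \<Otimes>\<^sub>M borel) (\<lambda>\<omega>. (Re (X \<omega>), Im (X \<omega>)))) borel (\<lambda>p. Complex (fst p) (snd p))"
    by (simp add: cgauss_eq_distr)
  also have "\<dots> = distr M borel X"
    by (subst distr_distr) (auto simp: o_def)
  finally show ?thesis by simp
qed

section \<open>Unitary invariance of a pair of complex Gaussians\<close>

text \<open>For a fixed second coordinate the shear is a translation of the first one.\<close>

lemma nn_integral_shear:
  fixes f :: "complex \<times> complex \<Rightarrow> ennreal"
  assumes [measurable]: "f \<in> borel_measurable (borel \<Otimes>\<^sub>M borel)"
  shows "(\<integral>\<^sup>+z. f (fst z + a * snd z, snd z) \<partial>(lborel \<Otimes>\<^sub>M lborel)) = (\<integral>\<^sup>+z. f z \<partial>(lborel \<Otimes>\<^sub>M lborel))"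
proof -
  have tr: "(\<integral>\<^sup>+p. f (p + w, q) \<partial>lborel) = (\<integral>\<^sup>+p. f (p, q) \<partial>lborel)" for w q
  proof -
    have "(\<integral>\<^sup>+p. f (p, q) \<partial>lborel) = (\<integral>\<^sup>+p. f (p, q) \<partial>(distr lborel borel ((+) w)))"
      by (simp add: lborel_distr_plus)
    also have "\<dots> = (\<integral>\<^sup>+p. f (w + p, q) \<partial>lborel)"
      by (rule nn_integral_distr) auto
    finally show ?thesis by (simp add: add.commute)
  qed
  have "(\<integral>\<^sup>+z. f (fst z + a * snd z, snd z) \<partial>(lborel \<Otimes>\<^sub>M lborel))
      = (\<integral>\<^sup>+q. \<integral>\<^sup>+p. f (p + a * q, q) \<partial>lborel \<partial>lborel)"
    by (subst lborel_pair.nn_integral_snd[symmetric]) (auto simp: case_prod_beta)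
  also have "\<dots> = (\<integral>\<^sup>+z. f z \<partial>(lborel \<Otimes>\<^sub>M lborel))"
    unfolding tr by (subst lborel_pair.nn_integral_snd[symmetric]) (auto simp: case_prod_beta)
  finally show ?thesis .
qed

lemma nn_integral_swap_lborel:
  fixes f :: "complex \<times> complex \<Rightarrow> ennreal"
  assumes [measurable]: "f \<in> borel_measurable (borel \<Otimes>\<^sub>M borel)"
  shows "(\<integral>\<^sup>+z. f (snd z, fst z) \<partial>(lborel \<Otimes>\<^sub>M lborel)) = (\<integral>\<^sup>+z. f z \<partial>(lborel \<Otimes>\<^sub>M lborel))"
  by (subst (2) lborel_pair.distr_pair_swap, subst nn_integral_distr)
     (auto simp: case_prod_beta cong: measurable_cong_sets)

lemma nn_integral_shear':
  fixes f :: "complex \<times> complex \<Rightarrow> ennreal"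
  assumes [measurable]: "f \<in> borel_measurable (borel \<Otimes>\<^sub>M borel)"
  shows "(\<integral>\<^sup>+z. f (fst z, snd z + a * fst z) \<partial>(lborel \<Otimes>\<^sub>M lborel)) = (\<integral>\<^sup>+z. f z \<partial>(lborel \<Otimes>\<^sub>M lborel))"
proof -
  have "(\<integral>\<^sup>+z. f (fst z, snd z + a * fst z) \<partial>(lborel \<Otimes>\<^sub>M lborel))
     = (\<integral>\<^sup>+z. f (snd z, fst z + a * snd z) \<partial>(lborel \<Otimes>\<^sub>M lborel))"
    using nn_integral_swap_lborel[of "\<lambda>z. f (fst z, snd z + a * fst z)"] by simp
  also have "\<dots> = (\<integral>\<^sup>+z. f (snd z, fst z) \<partial>(lborel \<Otimes>\<^sub>M lborel))"
    using nn_integral_shear[of "\<lambda>z. f (snd z, fst z)"] by simp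
  also have "\<dots> = (\<integral>\<^sup>+z. f z \<partial>(lborel \<Otimes>\<^sub>M lborel))"
    by (rule nn_integral_swap_lborel) simp
  finally show ?thesis .
qed

text \<open>For \<open>(cmod c)\<^sup>2 + (cmod s)\<^sup>2 = 1\<close> this is the general element
  of SU(2), acting on pairs.\<close>

definition rot :: "complex \<Rightarrow> complex \<Rightarrow> complex \<times> complex \<Rightarrow> complex \<times> complex" where
  "rot c s = (\<lambda>z. (c * fst z - cnj s * snd z, s * fst z + cnj c * snd z))"

lemma measurable_rot [measurable]: "rot c s \<in> measurable (borel \<Otimes>\<^sub>M borel) (borel \<Otimes>\<^sub>M borel)"
  unfolding rot_def by measurable

lemma unit_pair_complex:
  assumes "(cmod c)\<^sup>2 + (cmod s)\<^sup>2 = 1"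
  shows "c * cnj c + s * cnj s = 1"
  using assms by (metis complex_norm_square of_real_add of_real_1)

lemma rot_norm:
  assumes "(cmod c)\<^sup>2 + (cmod s)\<^sup>2 = 1"
  shows "(cmod (c * p - cnj s * q))\<^sup>2 + (cmod (s * p + cnj c * q))\<^sup>2 = (cmod p)\<^sup>2 + (cmod q)\<^sup>2"
proof -
  have "complex_of_real ((cmod (c * p - cnj s * q))\<^sup>2 + (cmod (s * p + cnj c * q))\<^sup>2)
     = (c * cnj c + s * cnj s) * (p * cnj p + q * cnj q)"
    by (simp only: of_real_add complex_norm_square) (simp add: algebra_simps)
  also have "\<dots> = complex_of_real ((cmod p)\<^sup>2 + (cmod q)\<^sup>2)"
    unfolding unit_pair_complex[OF assms] by (simp only: of_real_add complex_norm_square mult_1_left)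
  finally show ?thesis using of_real_eq_iff by blast
qed

text \<open>A unitary matrix with nonzero lower left entry is a product of three shears.\<close>

lemma nn_integral_rot_lborel:
  fixes f :: "complex \<times> complex \<Rightarrow> ennreal"
  assumes [measurable]: "f \<in> borel_measurable (borel \<Otimes>\<^sub>M borel)"
    and u: "(cmod c)\<^sup>2 + (cmod s)\<^sup>2 = 1" and s: "s \<noteq> 0"
  shows "(\<integral>\<^sup>+z. f (rot c s z) \<partial>(lborel \<Otimes>\<^sub>M lborel)) = (\<integral>\<^sup>+z. f z \<partial>(lborel \<Otimes>\<^sub>M lborel))"
proof -
  \<comment> \<open>Comparing the product of \<open>U a\<close>, \<open>L s\<close>,
    \<open>U b\<close> with \<open>rot c s\<close> forces these values: the diagonal entries
    determine \<open>a\<close> and \<open>b\<close>, and determinant one then yields the upper right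
    entry.\<close>
  define a b where "a = (c - 1) / s" and "b = (cnj c - 1) / s"
  define U where "U = (\<lambda>t (z::complex\<times>complex). (fst z + t * snd z, snd z))"
  define L where "L = (\<lambda>t (z::complex\<times>complex). (fst z, snd z + t * fst z))"
  have [measurable]: "U t \<in> measurable (borel \<Otimes>\<^sub>M borel) (borel \<Otimes>\<^sub>M borel)"
    "L t \<in> measurable (borel \<Otimes>\<^sub>M borel) (borel \<Otimes>\<^sub>M borel)" for t
    by (auto simp: U_def L_def)
  have 1: "1 + a * s = c" and 2: "1 + s * b = cnj c"
    using s by (auto simp: a_def b_def)
  have "c * b + a = (c * cnj c - 1) / s"
    using s by (simp add: a_def b_def field_simps)
  also have "c * cnj c - 1 = - s * cnj s"
    using unit_pair_complex[OF u] by (simp add: algebra_simps)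
  finally have 3: "c * b + a = - cnj s"
    using s by simp
  have "rot c s z = ((1 + a * s) * fst z + ((1 + a * s) * b + a) * snd z, s * fst z + (1 + s * b) * snd z)" for z
    unfolding 1 2 3 by (simp add: rot_def)
  then have "rot c s z = U a (L s (U b z))" for z
    by (simp add: U_def L_def algebra_simps)
  then have "(\<integral>\<^sup>+z. f (rot c s z) \<partial>(lborel \<Otimes>\<^sub>M lborel)) = (\<integral>\<^sup>+z. f (U a (L s (U b z))) \<partial>(lborel \<Otimes>\<^sub>M lborel))"
    by simp
  also have "\<dots> = (\<integral>\<^sup>+z. f (U a (L s z)) \<partial>(lborel \<Otimes>\<^sub>M lborel))"
    using nn_integral_shear[of "\<lambda>z. f (U a (L s z))" b] by (simp add: U_def)
  also have "\<dots> = (\<integral>\<^sup>+z. f (U a z) \<partial>(lborel \<Otimes>\<^sub>M lborel))"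
    using nn_integral_shear'[of "\<lambda>z. f (U a z)" s] by (simp add: L_def)
  also have "\<dots> = (\<integral>\<^sup>+z. f z \<partial>(lborel \<Otimes>\<^sub>M lborel))"
    using nn_integral_shear[of f a] by (simp add: U_def)
  finally show ?thesis .
qed

text \<open>The joint density depends only on the squared norm of the pair, which a unitary map
  preserves, and Lebesgue measure is invariant as well.\<close>

lemma nn_integral_rot_cgauss:
  fixes f :: "complex \<times> complex \<Rightarrow> ennreal"
  assumes [measurable]: "f \<in> borel_measurable (borel \<Otimes>\<^sub>M borel)"
    and u: "(cmod c)\<^sup>2 + (cmod s)\<^sup>2 = 1" and s: "s \<noteq> 0"
  shows "(\<integral>\<^sup>+z. f (rot c s z) \<partial>(cgauss \<Otimes>\<^sub>M cgauss)) = (\<integral>\<^sup>+z. f z \<partial>(cgauss \<Otimes>\<^sub>M cgauss))"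
proof -
  define D :: "complex \<times> complex \<Rightarrow> ennreal"
    where "D = (\<lambda>z. ennreal (exp (- ((cmod (fst z))\<^sup>2 + (cmod (snd z))\<^sup>2)) / pi\<^sup>2))"
  have [measurable]: "D \<in> borel_measurable (borel \<Otimes>\<^sub>M borel)" by (auto simp: D_def)
  have "cgauss \<Otimes>\<^sub>M cgauss = density (lborel \<Otimes>\<^sub>M lborel)
      (\<lambda>(x, y). ennreal (exp (- (cmod x)\<^sup>2) / pi) * ennreal (exp (- (cmod y)\<^sup>2) / pi))"
    unfolding cgauss_def
    by (rule pair_measure_density)
      (auto intro: sigma_finite_lborel cgauss.sigma_finite_measure_axioms[unfolded cgauss_def])
  also have "(\<lambda>(x, y). ennreal (exp (- (cmod x)\<^sup>2) / pi) * ennreal (exp (- (cmod y)\<^sup>2) / pi)) = D"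
    by (auto simp: fun_eq_iff D_def ennreal_mult[symmetric] mult_exp_exp power2_eq_square)
  finally have dens: "cgauss \<Otimes>\<^sub>M cgauss = density (lborel \<Otimes>\<^sub>M lborel) D" .
  have inv: "D (rot c s z) = D z" for z
    using rot_norm[OF u, of "fst z" "snd z"] unfolding D_def rot_def fst_conv snd_conv by (simp only:)
  have "(\<integral>\<^sup>+z. f (rot c s z) \<partial>(cgauss \<Otimes>\<^sub>M cgauss))
      = (\<integral>\<^sup>+z. D (rot c s z) * f (rot c s z) \<partial>(lborel \<Otimes>\<^sub>M lborel))"
    unfolding dens inv by (rule nn_integral_density) auto
  also have "\<dots> = (\<integral>\<^sup>+z. D z * f z \<partial>(lborel \<Otimes>\<^sub>M lborel))"
    by (rule nn_integral_rot_lborel[where f="\<lambda>z. D z * f z", OF _ u s]) auto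
  also have "\<dots> = (\<integral>\<^sup>+z. f z \<partial>(cgauss \<Otimes>\<^sub>M cgauss))"
    unfolding dens by (rule nn_integral_density[symmetric]) auto
  finally show ?thesis .
qed

section \<open>Laplace transform and characteristic function of one Gaussian\<close>

lemma nn_integral_scale_complex:
  fixes f :: "complex \<Rightarrow> ennreal"
  assumes [measurable]: "f \<in> borel_measurable borel" and c: "c > 0"
  shows "(\<integral>\<^sup>+z. f z \<partial>lborel) = ennreal (c\<^sup>2) * (\<integral>\<^sup>+z. f (of_real c * z) \<partial>lborel)"
  using c by (subst lborel_affine[of c 0])
    (simp_all add: nn_integral_density nn_integral_distr nn_integral_cmult scaleR_conv_of_real)

text \<open>Substituting \<open>of_real (sqrt a) * z\<close> in the total mass of
  \<open>cgauss\<close> produces this integral, with Jacobian \<open>a\<close>.\<close>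

lemma nn_integral_exp_cmod:
  assumes a: "a > 0"
  shows "(\<integral>\<^sup>+z. ennreal (exp (- (a * (cmod z)\<^sup>2))) \<partial>lborel) = ennreal (pi / a)"
proof -
  have "1 = (\<integral>\<^sup>+z. 1 \<partial>cgauss)" using cgauss.emeasure_space_1 by simp
  also have "\<dots> = (\<integral>\<^sup>+z. ennreal (exp (- (cmod z)\<^sup>2) / pi) \<partial>lborel)"
    unfolding cgauss_def by (subst nn_integral_density) auto
  also have "\<dots> = ennreal ((sqrt a)\<^sup>2) * (\<integral>\<^sup>+z. ennreal (exp (- (cmod (of_real (sqrt a) * z))\<^sup>2) / pi) \<partial>lborel)"
    using a by (subst nn_integral_scale_complex[of _ "sqrt a"]) auto
  also have "\<dots> = ennreal a * (\<integral>\<^sup>+z. ennreal (1/pi) * ennreal (exp (- (a * (cmod z)\<^sup>2))) \<partial>lborel)"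
    using a by (simp add: norm_mult power_mult_distrib ennreal_mult[symmetric])
  also have "\<dots> = ennreal (a / pi) * (\<integral>\<^sup>+z. ennreal (exp (- (a * (cmod z)\<^sup>2))) \<partial>lborel)"
    using a by (subst nn_integral_cmult) (auto simp: mult.assoc[symmetric] ennreal_mult[symmetric])
  finally have *: "1 = ennreal (a / pi) * (\<integral>\<^sup>+z. ennreal (exp (- (a * (cmod z)\<^sup>2))) \<partial>lborel)" .
  have "ennreal (pi / a) * 1 = ennreal (pi / a * (a / pi)) * (\<integral>\<^sup>+z. ennreal (exp (- (a * (cmod z)\<^sup>2))) \<partial>lborel)"
    using a by (subst *, subst ennreal_mult) (simp_all add: mult.assoc)
  then show ?thesis using a by simp
qed

lemma nn_integral_laplace_cgauss:
  assumes a: "a \<ge> 0"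
  shows "(\<integral>\<^sup>+z. ennreal (exp (- (a * (cmod z)\<^sup>2))) \<partial>cgauss) = ennreal (1 / (1 + a))"
proof -
  have "(\<integral>\<^sup>+z. ennreal (exp (- (a * (cmod z)\<^sup>2))) \<partial>cgauss)
     = (\<integral>\<^sup>+z. ennreal (1/pi) * ennreal (exp (- ((1 + a) * (cmod z)\<^sup>2))) \<partial>lborel)"
    unfolding cgauss_def
    by (subst nn_integral_density) (auto simp: ennreal_mult[symmetric] mult_exp_exp algebra_simps)
  also have "\<dots> = ennreal (1/pi) * ennreal (pi / (1 + a))"
    using a by (subst nn_integral_cmult) (auto simp: nn_integral_exp_cmod)
  also have "\<dots> = ennreal (1 / (1 + a))"
    using a by (simp add: ennreal_mult[symmetric])
  finally show ?thesis .
qed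

text \<open>\<open>half_normal\<close> is the law of \<open>x / sqrt 2\<close> for a standard normal
  \<open>x\<close>, whose characteristic function is known.\<close>

lemma char_half_normal: "(LINT x|half_normal. cis (t * x)) = of_real (exp (- t\<^sup>2 / 4))"
proof -
  have "(LINT x|half_normal. cis (t * x))
     = (LINT x|distr std_normal_distribution borel (\<lambda>x. x / sqrt 2). cis (t * x))"
  proof -
    interpret prob_space std_normal_distribution
      by (rule real_distribution.axioms, rule real_dist_normal_dist)
    have "distributed std_normal_distribution lborel (\<lambda>x. 0 + (1 / sqrt 2) * x) (normal_density (0 + (1 / sqrt 2) * 0) (\<bar>1 / sqrt 2\<bar> * 1))"
      by (rule normal_density_affine) (auto simp: distributed_def distr_id2)
    then have "distr std_normal_distribution lborel (\<lambda>x. x / sqrt 2) = half_normal"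
      by (simp add: distributed_def real_sqrt_divide)
    then show ?thesis by (simp cong: distr_cong)
  qed
  also have "\<dots> = char std_normal_distribution (t / sqrt 2)"
    by (subst integral_distr) (auto simp: char_def cis_conv_exp borel_measurable_continuous_onI)
  also have "\<dots> = of_real (exp (- t\<^sup>2 / 4))"
    by (simp add: char_std_normal_distribution power_divide)
  finally show ?thesis .
qed

lemma measurable_cis [measurable]: "cis \<in> borel_measurable borel"
  by (intro borel_measurable_continuous_onI continuous_intros)

text \<open>As \<open>Re (w * z) = Re w * Re z - Im w * Im z\<close>, independence of the two parts
  splits the integral into two real characteristic functions.\<close>

lemma char_cgauss: "(LINT z|cgauss. cis (Re (w * z))) = of_real (exp (- (cmod w)\<^sup>2 / 4))"
proof -
  interpret p: pair_prob_space half_normal half_normal ..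
  have int: "integrable (half_normal \<Otimes>\<^sub>M half_normal) (\<lambda>p. cis (Re w * fst p) * cis (- Im w * snd p))"
    by (rule p.integrable_const_bound[of _ 1]) (auto simp: norm_mult)
  have "(LINT z|cgauss. cis (Re (w * z)))
     = (LINT p|(half_normal \<Otimes>\<^sub>M half_normal). cis (Re w * fst p) * cis (- Im w * snd p))"
    unfolding cgauss_eq_distr by (subst integral_distr) (auto simp: cis_mult)
  also have "\<dots> = (LINT x|half_normal. LINT y|half_normal. cis (Re w * x) * cis (- Im w * y))"
    using p.integral_fst'[OF int] by simp
  also have "\<dots> = of_real (exp (- (cmod w)\<^sup>2 / 4))"
    using char_half_normal[of "Re w"] char_half_normal[of "- Im w"]
    by (simp add: cmod_power2 mult_exp_exp of_real_mult[symmetric] add_divide_distrib del: of_real_mult of_real_exp)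
  finally show ?thesis .
qed

section \<open>Rotations and linear images of Gaussian vectors\<close>

text \<open>A unitary change of variables turns the linear form with coefficients \<open>a\<close>,
  \<open>b\<close> into \<open>r\<close> times a single variable. Which variable is left open
  because the invariance above is stated for \<open>s \<noteq> 0\<close>.\<close>

lemma rotation_exists:
  fixes a b :: complex
  assumes "a \<noteq> 0 \<or> b \<noteq> 0"
  defines "r \<equiv> complex_of_real (sqrt ((cmod a)\<^sup>2 + (cmod b)\<^sup>2))"
  obtains c s where "(cmod c)\<^sup>2 + (cmod s)\<^sup>2 = 1" "s \<noteq> 0"
    "(\<forall>p q. a * (c * p - cnj s * q) + b * (s * p + cnj c * q) = r * p) \<or>
     (\<forall>p q. a * (c * p - cnj s * q) + b * (s * p + cnj c * q) = r * q)"
proof -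
  define \<rho> where "\<rho> = sqrt ((cmod a)\<^sup>2 + (cmod b)\<^sup>2)"
  have pos: "(cmod a)\<^sup>2 + (cmod b)\<^sup>2 > 0"
    using assms(1) by (auto simp: sum_power2_gt_zero_iff)
  have \<rho>: "\<rho> > 0" "\<rho>\<^sup>2 = (cmod a)\<^sup>2 + (cmod b)\<^sup>2" "r = of_real \<rho>"
    using pos by (auto simp: \<rho>_def r_def)
  have rr: "a * cnj a + b * cnj b = r * r"
  proof -
    have "a * cnj a + b * cnj b = complex_of_real ((cmod a)\<^sup>2 + (cmod b)\<^sup>2)"
      by (simp only: of_real_add complex_norm_square)
    also have "\<dots> = r * r"
      by (simp only: \<rho>(2)[symmetric] \<rho>(3)) (simp add: power2_eq_square)
    finally show ?thesis .
  qed
  have r: "r \<noteq> 0" "cnj r = r" using \<rho> by auto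
  show thesis
  proof (cases "b = 0")
    case False
    \<comment> \<open>The first column of the unitary matrix is the normalized conjugate of the
      coefficient vector.\<close>
    show thesis
    proof (rule that[of "cnj a / r" "cnj b / r"])
      show "(cmod (cnj a / r))\<^sup>2 + (cmod (cnj b / r))\<^sup>2 = 1"
        using \<rho> pos by (simp add: norm_divide power_divide add_divide_distrib[symmetric] sum_power2_eq_zero_iff)
          (use assms(1) in blast)
      have "a * (cnj a / r * p - cnj (cnj b / r) * q) + b * (cnj b / r * p + cnj (cnj a / r) * q)
          = (a * cnj a + b * cnj b) / r * p" for p q
        using r by (simp add: field_simps)
      then show "(\<forall>p q. a * (cnj a / r * p - cnj (cnj b / r) * q) + b * (cnj b / r * p + cnj (cnj a / r) * q) = r * p) \<or>
        (\<forall>p q. a * (cnj a / r * p - cnj (cnj b / r) * q) + b * (cnj b / r * p + cnj (cnj a / r) * q) = r * q)"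
        unfolding rr using r by simp
    qed (use False r in auto)
  next
    case True
    \<comment> \<open>The choice of the other case would give \<open>s = 0\<close> here; a matrix
      with \<open>c = 0\<close> exchanges the two variables instead.\<close>
    show thesis
    proof (rule that[of 0 "- a / r"])
      show "(cmod 0)\<^sup>2 + (cmod (- a / r))\<^sup>2 = 1"
        using \<rho> pos True by (simp add: norm_divide power_divide)
      have "a * (0 * p - cnj (- a / r) * q) + b * (- a / r * p + cnj 0 * q) = (a * cnj a + b * cnj b) / r * q" for p q
        using r True by (simp add: field_simps)
      then show "(\<forall>p q. a * (0 * p - cnj (- a / r) * q) + b * (- a / r * p + cnj 0 * q) = r * p) \<or>
        (\<forall>p q. a * (0 * p - cnj (- a / r) * q) + b * (- a / r * p + cnj 0 * q) = r * q)"
        unfolding rr using r by simp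
    qed (use True assms r in auto)
  qed
qed

section \<open>Linear combinations of independent Gaussians\<close>

interpretation cgauss_pair: pair_prob_space cgauss cgauss ..

text \<open>Rotate so that the linear form involves only one variable; the other one integrates to
  one.\<close>

lemma nn_integral_lincomb2_cgauss:
  fixes f :: "complex \<Rightarrow> ennreal"
  assumes [measurable]: "f \<in> borel_measurable borel"
  shows "(\<integral>\<^sup>+z. f (a * fst z + b * snd z) \<partial>(cgauss \<Otimes>\<^sub>M cgauss))
     = (\<integral>\<^sup>+z. f (of_real (sqrt ((cmod a)\<^sup>2 + (cmod b)\<^sup>2)) * z) \<partial>cgauss)"
proof -
  define r where "r = complex_of_real (sqrt ((cmod a)\<^sup>2 + (cmod b)\<^sup>2))"
  have f1: "(\<integral>\<^sup>+z. f (r * fst z) \<partial>(cgauss \<Otimes>\<^sub>M cgauss)) = (\<integral>\<^sup>+z. f (r * z) \<partial>cgauss)"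
    by (subst cgauss.nn_integral_fst[symmetric]) (auto simp: cgauss.emeasure_space_1[simplified])
  have f2: "(\<integral>\<^sup>+z. f (r * snd z) \<partial>(cgauss \<Otimes>\<^sub>M cgauss)) = (\<integral>\<^sup>+z. f (r * z) \<partial>cgauss)"
    by (subst cgauss.nn_integral_fst[symmetric]) (auto simp: cgauss.emeasure_space_1[simplified])
  show ?thesis
  proof (cases "a = 0 \<and> b = 0")
    case True
    then show ?thesis using f1 by (simp add: r_def)
  next
    case False
    then obtain c s where cs: "(cmod c)\<^sup>2 + (cmod s)\<^sup>2 = 1" "s \<noteq> 0"
      and alt: "(\<forall>p q. a * (c * p - cnj s * q) + b * (s * p + cnj c * q) = r * p) \<or>
       (\<forall>p q. a * (c * p - cnj s * q) + b * (s * p + cnj c * q) = r * q)"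
      unfolding r_def by (metis rotation_exists)
    have "(\<integral>\<^sup>+z. f (a * fst z + b * snd z) \<partial>(cgauss \<Otimes>\<^sub>M cgauss))
       = (\<integral>\<^sup>+z. f (a * fst (rot c s z) + b * snd (rot c s z)) \<partial>(cgauss \<Otimes>\<^sub>M cgauss))"
      by (rule nn_integral_rot_cgauss[OF _ cs, symmetric]) auto
    also have "\<dots> = (\<integral>\<^sup>+z. f (r * z) \<partial>cgauss)"
      using alt by (elim disjE) (simp_all add: rot_def f1 f2)
    finally show ?thesis by (simp add: r_def)
  qed
qed

interpretation cgauss_prod: product_sigma_finite "\<lambda>_. cgauss"
  by unfold_locales

abbreviation cgauss_vec :: "'i set \<Rightarrow> ('i \<Rightarrow> complex) measure" where
  "cgauss_vec K \<equiv> Pi\<^sub>M K (\<lambda>_. cgauss)"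

lemma prob_space_cgauss_vec: "prob_space (cgauss_vec K)"
  by (rule prob_space_PiM) (rule cgauss.prob_space_axioms)

text \<open>Induction on \<open>K\<close>: the sum over the earlier indices acts like one Gaussian
  of scale \<open>\<rho>\<close>, which the two-variable case merges with the new term.\<close>

lemma nn_integral_lincomb_cgauss_vec:
  fixes f :: "complex \<Rightarrow> ennreal"
  assumes "finite K" and [measurable]: "f \<in> borel_measurable borel"
  shows "(\<integral>\<^sup>+x. f (\<Sum>k\<in>K. h k * x k) \<partial>cgauss_vec K)
     = (\<integral>\<^sup>+z. f (of_real (sqrt (\<Sum>k\<in>K. (cmod (h k))\<^sup>2)) * z) \<partial>cgauss)"
  using assms(1) assms(2)
proof (induction K arbitrary: f rule: finite_induct)
  case empty
  interpret prob_space "cgauss_vec ({}::'a set)" by (rule prob_space_cgauss_vec)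
  show ?case by (simp add: emeasure_space_1 cgauss.emeasure_space_1[simplified])
next
  case (insert k K)
  note [measurable] = insert.prems
  define \<rho> where "\<rho> = complex_of_real (sqrt (\<Sum>k\<in>K. (cmod (h k))\<^sup>2))"
  have "(\<integral>\<^sup>+x. f (\<Sum>k\<in>insert k K. h k * x k) \<partial>cgauss_vec (insert k K))
     = (\<integral>\<^sup>+y. \<integral>\<^sup>+x. f (\<Sum>j\<in>insert k K. h j * (x(k := y)) j) \<partial>cgauss_vec K \<partial>cgauss)"
    using insert.hyps by (intro cgauss_prod.product_nn_integral_insert_rev) auto
  also have "\<dots> = (\<integral>\<^sup>+y. \<integral>\<^sup>+x. f (h k * y + (\<Sum>j\<in>K. h j * x j)) \<partial>cgauss_vec K \<partial>cgauss)"
  proof (intro nn_integral_cong arg_cong[where f=f])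
    fix y x
    have "(\<Sum>j\<in>K. h j * (x(k := y)) j) = (\<Sum>j\<in>K. h j * x j)"
      using insert.hyps by (intro sum.cong) auto
    then show "(\<Sum>j\<in>insert k K. h j * (x(k := y)) j) = h k * y + (\<Sum>j\<in>K. h j * x j)"
      using insert.hyps by simp
  qed
  also have "\<dots> = (\<integral>\<^sup>+y. \<integral>\<^sup>+z. f (h k * y + \<rho> * z) \<partial>cgauss \<partial>cgauss)"
  proof (rule nn_integral_cong)
    fix y
    show "(\<integral>\<^sup>+x. f (h k * y + (\<Sum>j\<in>K. h j * x j)) \<partial>cgauss_vec K) = (\<integral>\<^sup>+z. f (h k * y + \<rho> * z) \<partial>cgauss)"
      using insert.IH[of "\<lambda>w. f (h k * y + w)"] by (simp add: \<rho>_def)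
  qed
  also have "\<dots> = (\<integral>\<^sup>+z. f (h k * fst z + \<rho> * snd z) \<partial>(cgauss \<Otimes>\<^sub>M cgauss))"
    by (subst cgauss.nn_integral_fst[symmetric]) auto
  also have "\<dots> = (\<integral>\<^sup>+z. f (of_real (sqrt (\<Sum>k\<in>insert k K. (cmod (h k))\<^sup>2)) * z) \<partial>cgauss)"
    using insert.hyps
    by (subst nn_integral_lincomb2_cgauss) (auto simp: \<rho>_def sum_nonneg)
  finally show ?case .
qed

text \<open>Indicators as test functions give equality of laws, which then also covers complex
  oscillating integrands.\<close>

lemma distr_lincomb_cgauss_vec:
  assumes "finite K"
  shows "distr (cgauss_vec K) borel (\<lambda>x. \<Sum>k\<in>K. h k * x k)
    = distr cgauss borel (\<lambda>z. of_real (sqrt (\<Sum>k\<in>K. (cmod (h k))\<^sup>2)) * z)"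
proof (rule measure_eqI)
  fix A assume "A \<in> sets (distr (cgauss_vec K) borel (\<lambda>x. \<Sum>k\<in>K. h k * x k))"
  then have [measurable]: "A \<in> sets borel" by simp
  have *: "emeasure (distr N borel g) A = (\<integral>\<^sup>+x. indicator A (g x) \<partial>N)"
    if "g \<in> borel_measurable N" for g :: "'c \<Rightarrow> complex" and N
    using that by (simp add: nn_integral_distr flip: nn_integral_indicator)
  show "emeasure (distr (cgauss_vec K) borel (\<lambda>x. \<Sum>k\<in>K. h k * x k)) A
    = emeasure (distr cgauss borel (\<lambda>z. of_real (sqrt (\<Sum>k\<in>K. (cmod (h k))\<^sup>2)) * z)) A"
    by (subst (1 2) *) (measurable, rule nn_integral_lincomb_cgauss_vec[OF assms], measurable)
qed simp

lemma char_cgauss_vec: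
  assumes "finite K"
  shows "(LINT x|cgauss_vec K. cis (Re (\<Sum>k\<in>K. h k * x k))) = of_real (exp (- (\<Sum>k\<in>K. (cmod (h k))\<^sup>2) / 4))"
proof -
  have "(LINT x|cgauss_vec K. cis (Re (\<Sum>k\<in>K. h k * x k)))
      = (LINT w|distr (cgauss_vec K) borel (\<lambda>x. \<Sum>k\<in>K. h k * x k). cis (Re w))"
    by (rule integral_distr[symmetric]) auto
  also have "\<dots> = (LINT z|cgauss. cis (Re (of_real (sqrt (\<Sum>k\<in>K. (cmod (h k))\<^sup>2)) * z)))"
    unfolding distr_lincomb_cgauss_vec[OF assms] by (rule integral_distr) measurable
  also have "\<dots> = of_real (exp (- (\<Sum>k\<in>K. (cmod (h k))\<^sup>2) / 4))"
    unfolding char_cgauss by (simp add: sum_nonneg)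
  finally show ?thesis .
qed

section \<open>Unitary mixing of two Gaussian vectors\<close>

definition rot_vec :: "'i set \<Rightarrow> complex \<Rightarrow> complex \<Rightarrow> ('i \<Rightarrow> complex) \<times> ('i \<Rightarrow> complex) \<Rightarrow> ('i \<Rightarrow> complex) \<times> ('i \<Rightarrow> complex)" where
  "rot_vec K c s z = (\<lambda>k\<in>K. c * fst z k - cnj s * snd z k, \<lambda>k\<in>K. s * fst z k + cnj c * snd z k)"

lemma measurable_rot_vec [measurable]: "rot_vec K c s \<in> measurable (cgauss_vec K \<Otimes>\<^sub>M cgauss_vec K) (cgauss_vec K \<Otimes>\<^sub>M cgauss_vec K)"
  unfolding rot_vec_def by measurable

text \<open>Regroups the integral so that the coordinates at \<open>k\<close> of both copies form an
  inner pair, to which the two-variable invariance applies.\<close>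

lemma nn_integral_cgauss_vec_pair_insert:
  assumes K: "finite K" "k \<notin> K"
    and [measurable]: "g \<in> borel_measurable (cgauss_vec (insert k K) \<Otimes>\<^sub>M cgauss_vec (insert k K))"
  shows "(\<integral>\<^sup>+z. g z \<partial>(cgauss_vec (insert k K) \<Otimes>\<^sub>M cgauss_vec (insert k K)))
    = (\<integral>\<^sup>+y. \<integral>\<^sup>+w. g ((fst y)(k := fst w), (snd y)(k := snd w)) \<partial>(cgauss \<Otimes>\<^sub>M cgauss) \<partial>(cgauss_vec K \<Otimes>\<^sub>M cgauss_vec K))"
proof -
  interpret G: prob_space "cgauss_vec K" by (rule prob_space_cgauss_vec)
  interpret G': prob_space "cgauss_vec (insert k K)" by (rule prob_space_cgauss_vec)
  interpret GC: pair_sigma_finite "cgauss_vec K" cgauss ..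
  interpret CG: pair_sigma_finite cgauss "cgauss_vec K" ..
  have "(\<integral>\<^sup>+z. g z \<partial>(cgauss_vec (insert k K) \<Otimes>\<^sub>M cgauss_vec (insert k K)))
     = (\<integral>\<^sup>+x. \<integral>\<^sup>+x'. g (x, x') \<partial>cgauss_vec (insert k K) \<partial>cgauss_vec (insert k K))"
    by (rule G'.nn_integral_fst[symmetric]) simp
  also have "\<dots> = (\<integral>\<^sup>+y. \<integral>\<^sup>+p. \<integral>\<^sup>+x'. g (y(k := p), x') \<partial>cgauss_vec (insert k K) \<partial>cgauss \<partial>cgauss_vec K)"
    using K by (intro cgauss_prod.product_nn_integral_insert) auto
  also have "\<dots> = (\<integral>\<^sup>+y. \<integral>\<^sup>+p. \<integral>\<^sup>+y'. \<integral>\<^sup>+q. g (y(k := p), y'(k := q)) \<partial>cgauss \<partial>cgauss_vec K \<partial>cgauss \<partial>cgauss_vec K)"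
  proof (intro nn_integral_cong)
    fix y p assume [measurable]: "y \<in> space (cgauss_vec K)"
    have [measurable]: "y(k := p) \<in> space (cgauss_vec (insert k K))"
      using \<open>y \<in> space (cgauss_vec K)\<close> by (auto simp: space_PiM PiE_def extensional_def)
    show "(\<integral>\<^sup>+x'. g (y(k := p), x') \<partial>cgauss_vec (insert k K)) = (\<integral>\<^sup>+y'. \<integral>\<^sup>+q. g (y(k := p), y'(k := q)) \<partial>cgauss \<partial>cgauss_vec K)"
      using K by (intro cgauss_prod.product_nn_integral_insert) auto
  qed
  also have "\<dots> = (\<integral>\<^sup>+y. \<integral>\<^sup>+y'. \<integral>\<^sup>+p. \<integral>\<^sup>+q. g (y(k := p), y'(k := q)) \<partial>cgauss \<partial>cgauss \<partial>cgauss_vec K \<partial>cgauss_vec K)"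
  proof (intro nn_integral_cong)
    fix y assume y [measurable]: "y \<in> space (cgauss_vec K)"
    show "(\<integral>\<^sup>+p. \<integral>\<^sup>+y'. \<integral>\<^sup>+q. g (y(k := p), y'(k := q)) \<partial>cgauss \<partial>cgauss_vec K \<partial>cgauss)
      = (\<integral>\<^sup>+y'. \<integral>\<^sup>+p. \<integral>\<^sup>+q. g (y(k := p), y'(k := q)) \<partial>cgauss \<partial>cgauss \<partial>cgauss_vec K)"
      by (rule GC.Fubini') measurable
  qed
  also have "\<dots> = (\<integral>\<^sup>+y. \<integral>\<^sup>+y'. \<integral>\<^sup>+w. g (y(k := fst w), y'(k := snd w)) \<partial>(cgauss \<Otimes>\<^sub>M cgauss) \<partial>cgauss_vec K \<partial>cgauss_vec K)"
  proof (intro nn_integral_cong)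
    fix y y' assume [measurable]: "y \<in> space (cgauss_vec K)" "y' \<in> space (cgauss_vec K)"
    show "(\<integral>\<^sup>+p. \<integral>\<^sup>+q. g (y(k := p), y'(k := q)) \<partial>cgauss \<partial>cgauss)
      = (\<integral>\<^sup>+w. g (y(k := fst w), y'(k := snd w)) \<partial>(cgauss \<Otimes>\<^sub>M cgauss))"
      by (subst cgauss.nn_integral_fst[symmetric]) auto
  qed
  also have "\<dots> = (\<integral>\<^sup>+y. \<integral>\<^sup>+w. g ((fst y)(k := fst w), (snd y)(k := snd w)) \<partial>(cgauss \<Otimes>\<^sub>M cgauss) \<partial>(cgauss_vec K \<Otimes>\<^sub>M cgauss_vec K))"
    by (subst G.nn_integral_fst[symmetric]) auto
  finally show ?thesis .
qed

text \<open>Induction on the index set: \<open>rot_vec\<close> acts as \<open>rot\<close> on the new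
  pair of coordinates and separately on the remaining ones.\<close>

lemma nn_integral_rot_vec:
  assumes "finite K" and "f \<in> borel_measurable (cgauss_vec K \<Otimes>\<^sub>M cgauss_vec K)"
    and u: "(cmod c)\<^sup>2 + (cmod s)\<^sup>2 = 1" and s: "s \<noteq> 0"
  shows "(\<integral>\<^sup>+z. f (rot_vec K c s z) \<partial>(cgauss_vec K \<Otimes>\<^sub>M cgauss_vec K)) = (\<integral>\<^sup>+z. f z \<partial>(cgauss_vec K \<Otimes>\<^sub>M cgauss_vec K))"
  using assms(1,2)
proof (induction K arbitrary: f rule: finite_induct)
  case empty
  show ?case
    by (intro nn_integral_cong) (auto simp: rot_vec_def space_pair_measure space_PiM_empty restrict_def)
next
  case (insert k K)
  note [measurable] = insert.prems
  define g where "g = (\<lambda>y. \<integral>\<^sup>+w. f ((fst y)(k := fst w), (snd y)(k := snd w)) \<partial>(cgauss \<Otimes>\<^sub>M cgauss))"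
  have g [measurable]: "g \<in> borel_measurable (cgauss_vec K \<Otimes>\<^sub>M cgauss_vec K)"
    unfolding g_def by measurable
  have "(\<integral>\<^sup>+z. f (rot_vec (insert k K) c s z) \<partial>(cgauss_vec (insert k K) \<Otimes>\<^sub>M cgauss_vec (insert k K)))
    = (\<integral>\<^sup>+y. \<integral>\<^sup>+w. f (rot_vec (insert k K) c s ((fst y)(k := fst w), (snd y)(k := snd w))) \<partial>(cgauss \<Otimes>\<^sub>M cgauss) \<partial>(cgauss_vec K \<Otimes>\<^sub>M cgauss_vec K))"
    using insert.hyps by (intro nn_integral_cgauss_vec_pair_insert) auto
  also have "\<dots> = (\<integral>\<^sup>+y. g (rot_vec K c s y) \<partial>(cgauss_vec K \<Otimes>\<^sub>M cgauss_vec K))"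
  proof (intro nn_integral_cong)
    fix y assume "y \<in> space (cgauss_vec K \<Otimes>\<^sub>M cgauss_vec K)"
    then have [measurable]: "rot_vec K c s y \<in> space (cgauss_vec K \<Otimes>\<^sub>M cgauss_vec K)"
      by (rule measurable_space[OF measurable_rot_vec])
    then have [measurable]: "fst (rot_vec K c s y) \<in> space (cgauss_vec K)" "snd (rot_vec K c s y) \<in> space (cgauss_vec K)"
      by (auto simp: space_pair_measure)
    have "(\<integral>\<^sup>+w. f (rot_vec (insert k K) c s ((fst y)(k := fst w), (snd y)(k := snd w))) \<partial>(cgauss \<Otimes>\<^sub>M cgauss))
       = (\<integral>\<^sup>+w. f ((fst (rot_vec K c s y))(k := fst (rot c s w)), (snd (rot_vec K c s y))(k := snd (rot c s w))) \<partial>(cgauss \<Otimes>\<^sub>M cgauss))"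
      using insert.hyps by (intro nn_integral_cong arg_cong[where f=f]) (auto simp: rot_vec_def rot_def fun_eq_iff)
    also have "\<dots> = g (rot_vec K c s y)"
      unfolding g_def by (rule nn_integral_rot_cgauss[OF _ u s]) measurable
    finally show "(\<integral>\<^sup>+w. f (rot_vec (insert k K) c s ((fst y)(k := fst w), (snd y)(k := snd w))) \<partial>(cgauss \<Otimes>\<^sub>M cgauss)) = g (rot_vec K c s y)" .
  qed
  also have "\<dots> = (\<integral>\<^sup>+y. g y \<partial>(cgauss_vec K \<Otimes>\<^sub>M cgauss_vec K))"
    by (rule insert.IH) measurable
  also have "\<dots> = (\<integral>\<^sup>+z. f z \<partial>(cgauss_vec (insert k K) \<Otimes>\<^sub>M cgauss_vec (insert k K)))"
    unfolding g_def using insert.hyps by (intro nn_integral_cgauss_vec_pair_insert[symmetric]) auto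
  finally show ?case .
qed

lemma integral_rot_vec:
  fixes f :: "('i \<Rightarrow> complex) \<times> ('i \<Rightarrow> complex) \<Rightarrow> complex"
  assumes K: "finite K" and [measurable]: "f \<in> borel_measurable (cgauss_vec K \<Otimes>\<^sub>M cgauss_vec K)"
    and u: "(cmod c)\<^sup>2 + (cmod s)\<^sup>2 = 1" and s: "s \<noteq> 0"
  shows "(LINT z|(cgauss_vec K \<Otimes>\<^sub>M cgauss_vec K). f (rot_vec K c s z)) = (LINT z|(cgauss_vec K \<Otimes>\<^sub>M cgauss_vec K). f z)"
proof -
  have "distr (cgauss_vec K \<Otimes>\<^sub>M cgauss_vec K) (cgauss_vec K \<Otimes>\<^sub>M cgauss_vec K) (rot_vec K c s) = cgauss_vec K \<Otimes>\<^sub>M cgauss_vec K"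
  proof (rule measure_eqI)
    fix A assume "A \<in> sets (distr (cgauss_vec K \<Otimes>\<^sub>M cgauss_vec K) (cgauss_vec K \<Otimes>\<^sub>M cgauss_vec K) (rot_vec K c s))"
    then have [measurable]: "A \<in> sets (cgauss_vec K \<Otimes>\<^sub>M cgauss_vec K)" by simp
    show "emeasure (distr (cgauss_vec K \<Otimes>\<^sub>M cgauss_vec K) (cgauss_vec K \<Otimes>\<^sub>M cgauss_vec K) (rot_vec K c s)) A = emeasure (cgauss_vec K \<Otimes>\<^sub>M cgauss_vec K) A"
      using nn_integral_rot_vec[OF K _ u s, of "indicator A"]
      by (simp add: nn_integral_distr flip: nn_integral_indicator)
  qed simp
  then have "(LINT z|(cgauss_vec K \<Otimes>\<^sub>M cgauss_vec K). f z) = (LINT z|distr (cgauss_vec K \<Otimes>\<^sub>M cgauss_vec K) (cgauss_vec K \<Otimes>\<^sub>M cgauss_vec K) (rot_vec K c s). f z)"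
    by simp
  also have "\<dots> = (LINT z|(cgauss_vec K \<Otimes>\<^sub>M cgauss_vec K). f (rot_vec K c s z))"
    by (rule integral_distr) auto
  finally show ?thesis by simp
qed

section \<open>An oscillatory Gaussian integral\<close>

definition qform :: "'i set \<Rightarrow> ('i \<Rightarrow> 'i \<Rightarrow> complex) \<Rightarrow> ('i \<Rightarrow> complex) \<Rightarrow> ('i \<Rightarrow> complex) \<Rightarrow> real" where
  "qform K \<tau> v x = (\<Sum>k\<in>K. (cmod ((\<Sum>l\<in>K. \<tau> k l * x l) + v k))\<^sup>2)"

text \<open>
  Up to a factor, the conditional characteristic function that arises when row \<open>d\<close> is integrated out and
  row \<open>a\<close> is the variable \<open>x\<close>; \<open>\<alpha>\<close> and \<open>\<beta>\<close> stand for \<open>u\<^sub>d\<close> and \<open>u\<^sub>a\<close>.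
\<close>

definition osc_int :: "'i set \<Rightarrow> ('i \<Rightarrow> 'i \<Rightarrow> complex) \<Rightarrow> ('i \<Rightarrow> complex) \<Rightarrow> complex \<Rightarrow> complex \<Rightarrow> complex" where
  "osc_int K \<tau> t \<alpha> \<beta> = (LINT x|cgauss_vec K. of_real (exp (- qform K \<tau> (\<lambda>k. \<beta> * t k) x / 4)) * cis (Re (\<Sum>l\<in>K. \<alpha> * t l * x l)))"

lemma cis_Re_add: "cis (Re (a + b)) = cis (Re a) * cis (Re b)"
  by (simp add: cis_mult)

lemma exp_neg_quarter_add: "exp (- (a + b) / 4) = exp (- a / 4) * exp (- b / 4 :: real)"
  by (simp add: mult_exp_exp add_divide_distrib)

lemma qform_nonneg: "qform K \<tau> v x \<ge> 0"
  by (simp add: qform_def sum_nonneg)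

lemma measurable_qform [measurable]: "qform K \<tau> v \<in> borel_measurable (cgauss_vec K)"
  unfolding qform_def by measurable

lemma qform_cong: "(\<And>k. k \<in> K \<Longrightarrow> x k = y k) \<Longrightarrow> qform K \<tau> v x = qform K \<tau> v y"
  unfolding qform_def by (intro sum.cong arg_cong2[where f="(+)"] arg_cong[where f="\<lambda>z. (cmod z)\<^sup>2"]) auto

text \<open>The linear map \<open>\<tau>\<close> commutes with mixing the copies, so each index
  contributes an instance of \<open>rot_norm\<close>.\<close>

lemma qform_rotate:
  assumes "(cmod c)\<^sup>2 + (cmod s)\<^sup>2 = 1"
  shows "qform K \<tau> (\<lambda>_. 0) (\<lambda>k. c * x k - cnj s * y k) + qform K \<tau> (\<lambda>_. 0) (\<lambda>k. s * x k + cnj c * y k)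
     = qform K \<tau> (\<lambda>_. 0) x + qform K \<tau> (\<lambda>_. 0) y"
proof -
  have "(\<Sum>l\<in>K. \<tau> k l * (c * x l - cnj s * y l)) = c * (\<Sum>l\<in>K. \<tau> k l * x l) - cnj s * (\<Sum>l\<in>K. \<tau> k l * y l)"
    "(\<Sum>l\<in>K. \<tau> k l * (s * x l + cnj c * y l)) = s * (\<Sum>l\<in>K. \<tau> k l * x l) + cnj c * (\<Sum>l\<in>K. \<tau> k l * y l)" for k
    by (simp_all add: sum_distrib_left sum.distrib sum_subtractf algebra_simps)
  then show ?thesis
    by (simp add: qform_def sum.distrib[symmetric] rot_norm[OF assms])
qed

text \<open>With \<open>w = q + sqrt 2 * v\<close> the two terms are \<open>(p + w) / sqrt 2\<close>
  and \<open>(w - p) / sqrt 2\<close>, and the parallelogram law applies.\<close>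

lemma cmod_parallelogram:
  fixes p q v :: complex
  shows
  "(cmod ((p + q) / sqrt 2 + v))\<^sup>2 + (cmod ((q - p) / sqrt 2 + v))\<^sup>2 = (cmod p)\<^sup>2 + (cmod (q + sqrt 2 * v))\<^sup>2"
proof -
  have 1: "(p + q) / sqrt 2 + v = (p + (q + sqrt 2 * v)) / sqrt 2"
    "(q - p) / sqrt 2 + v = ((q + sqrt 2 * v) - p) / sqrt 2"
    by (simp_all add: field_simps of_real_mult[symmetric] del: of_real_mult)
  have 2: "(cmod (a / sqrt 2))\<^sup>2 = (cmod a)\<^sup>2 / 2" for a :: complex
    by (simp add: norm_divide power_divide)
  have 3: "(cmod (p + w))\<^sup>2 + (cmod (w - p))\<^sup>2 = 2 * ((cmod p)\<^sup>2 + (cmod w)\<^sup>2)" for w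
    unfolding cmod_power2 by (simp add: power2_eq_square algebra_simps)
  show ?thesis
    unfolding 1 2 using 3[of "q + sqrt 2 * v"] by simp
qed

text \<open>Under a rotation by 45 degrees the shift cancels in one copy and is multiplied by
  \<open>sqrt 2\<close> in the other.\<close>

lemma qform_rotate_quarter:
  fixes x y v :: "'i \<Rightarrow> complex"
  shows
  "qform K \<tau> v (\<lambda>k. (x k + y k) / sqrt 2) + qform K \<tau> v (\<lambda>k. (y k - x k) / sqrt 2)
     = qform K \<tau> (\<lambda>_. 0) x + qform K \<tau> (\<lambda>k. sqrt 2 * v k) y"
proof -
  define S T where "S = (\<lambda>k. \<Sum>l\<in>K. \<tau> k l * x l)" and "T = (\<lambda>k. \<Sum>l\<in>K. \<tau> k l * y l)"
  have "(\<Sum>l\<in>K. \<tau> k l * ((x l + y l) / sqrt 2)) = (S k + T k) / sqrt 2"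
    "(\<Sum>l\<in>K. \<tau> k l * ((y l - x l) / sqrt 2)) = (T k - S k) / sqrt 2" for k
    by (simp_all add: S_def T_def sum_divide_distrib[symmetric] sum.distrib sum_subtractf algebra_simps)
  then show ?thesis
    by (simp only: qform_def S_def[symmetric] T_def[symmetric] sum.distrib[symmetric] cmod_parallelogram add_0_right)
      (simp only: S_def T_def)
qed

lemma integrable_cgauss_vec_bounded:
  assumes "f \<in> borel_measurable (cgauss_vec K)" "\<And>x. cmod (f x) \<le> 1"
  shows "integrable (cgauss_vec K) f"
proof -
  interpret prob_space "cgauss_vec K" by (rule prob_space_cgauss_vec)
  show ?thesis using assms by (intro integrable_const_bound[of _ 1]) auto
qed

lemma cgauss_vec_pair_integral_mult:
  fixes f g :: "('i \<Rightarrow> complex) \<Rightarrow> complex"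
  assumes [measurable]: "f \<in> borel_measurable (cgauss_vec K)" "g \<in> borel_measurable (cgauss_vec K)"
    and b: "\<And>x. cmod (f x) \<le> 1" "\<And>x. cmod (g x) \<le> 1"
  shows "(LINT z|(cgauss_vec K \<Otimes>\<^sub>M cgauss_vec K). f (fst z) * g (snd z)) = (LINT x|cgauss_vec K. f x) * (LINT x|cgauss_vec K. g x)"
proof -
  interpret prob_space "cgauss_vec K" by (rule prob_space_cgauss_vec)
  interpret P: pair_prob_space "cgauss_vec K" "cgauss_vec K" ..
  have "integrable (cgauss_vec K \<Otimes>\<^sub>M cgauss_vec K) (\<lambda>z. f (fst z) * g (snd z))"
    using b by (intro P.integrable_const_bound[of _ 1]) (auto simp: norm_mult intro!: mult_le_one)
  from P.integral_fst'[OF this] show ?thesis by simp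
qed

text \<open>
  The quadratic form on two independent copies is invariant under unitary mixing of the copies, and the
  mixing can be chosen to move the whole linear part to one of them.
\<close>

lemma osc_int_mult:
  assumes K: "finite K"
  shows "osc_int K \<tau> t \<alpha> 0 * osc_int K \<tau> t \<beta> 0
    = osc_int K \<tau> t (of_real (sqrt ((cmod \<alpha>)\<^sup>2 + (cmod \<beta>)\<^sup>2))) 0 * osc_int K \<tau> t 0 0"
proof (cases "\<alpha> = 0 \<and> \<beta> = 0")
  case False
  define r where "r = complex_of_real (sqrt ((cmod \<alpha>)\<^sup>2 + (cmod \<beta>)\<^sup>2))"
  define q where "q = qform K \<tau> (\<lambda>_. 0)"
  define I where "I = (\<lambda>a b (z::('a \<Rightarrow> complex) \<times> ('a \<Rightarrow> complex)).
     complex_of_real (exp (- (q (fst z) + q (snd z)) / 4)) * cis (Re (\<Sum>l\<in>K. t l * (a * fst z l + b * snd z l))))"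
  have [measurable]: "q \<in> borel_measurable (cgauss_vec K)" by (simp add: q_def)
  have [measurable]: "I a b \<in> borel_measurable (cgauss_vec K \<Otimes>\<^sub>M cgauss_vec K)" for a b
    unfolding I_def by measurable
  have prod: "osc_int K \<tau> t a 0 * osc_int K \<tau> t b 0 = (LINT z|(cgauss_vec K \<Otimes>\<^sub>M cgauss_vec K). I a b z)" for a b
  proof -
    define f where "f = (\<lambda>a x. complex_of_real (exp (- q x / 4)) * cis (Re (\<Sum>l\<in>K. a * t l * x l)))"
    have [measurable]: "f a \<in> borel_measurable (cgauss_vec K)" for a
      unfolding f_def by measurable
    have b: "cmod (f a x) \<le> 1" for a x by (simp add: f_def norm_mult q_def qform_nonneg)
    have "I a b z = f a (fst z) * f b (snd z)" for z
    proof -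
      have "(\<Sum>l\<in>K. t l * (a * fst z l + b * snd z l)) = (\<Sum>l\<in>K. a * t l * fst z l) + (\<Sum>l\<in>K. b * t l * snd z l)"
        by (simp add: sum.distrib[symmetric] algebra_simps)
      moreover have "exp (- (q (fst z) + q (snd z)) / 4) = exp (- q (fst z) / 4) * exp (- q (snd z) / 4)"
        by (rule exp_neg_quarter_add)
      ultimately show ?thesis
        by (simp only: I_def f_def cis_Re_add of_real_mult mult_ac)
    qed
    moreover have "osc_int K \<tau> t a 0 = integral\<^sup>L (cgauss_vec K) (f a)" for a
      by (simp only: osc_int_def f_def q_def mult_zero_left)
    ultimately show ?thesis
      by (simp add: cgauss_vec_pair_integral_mult b)
  qed
  \<comment> \<open>This mixing turns the linear part into \<open>r\<close> times a single copy,
    while the sum of the two quadratic forms stays the same.\<close>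
  obtain c s where cs: "(cmod c)\<^sup>2 + (cmod s)\<^sup>2 = 1" "s \<noteq> 0"
    and alt: "(\<forall>p q. \<alpha> * (c * p - cnj s * q) + \<beta> * (s * p + cnj c * q) = r * p) \<or>
     (\<forall>p q. \<alpha> * (c * p - cnj s * q) + \<beta> * (s * p + cnj c * q) = r * q)"
    using False unfolding r_def by (metis rotation_exists)
  have "(LINT z|(cgauss_vec K \<Otimes>\<^sub>M cgauss_vec K). I \<alpha> \<beta> z) = (LINT z|(cgauss_vec K \<Otimes>\<^sub>M cgauss_vec K). I \<alpha> \<beta> (rot_vec K c s z))"
    by (rule integral_rot_vec[symmetric, OF K _ cs]) simp
  also have "\<dots> = osc_int K \<tau> t r 0 * osc_int K \<tau> t 0 0"
  proof -
    have qr: "q (fst (rot_vec K c s z)) + q (snd (rot_vec K c s z)) = q (fst z) + q (snd z)" for z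
    proof -
      have "q (fst (rot_vec K c s z)) = q (\<lambda>k. c * fst z k - cnj s * snd z k)"
        "q (snd (rot_vec K c s z)) = q (\<lambda>k. s * fst z k + cnj c * snd z k)"
        unfolding q_def by (auto intro!: qform_cong simp: rot_vec_def)
      then show ?thesis using qform_rotate[OF cs(1)] by (simp add: q_def)
    qed
    have lr: "(\<Sum>l\<in>K. t l * (\<alpha> * fst (rot_vec K c s z) l + \<beta> * snd (rot_vec K c s z) l))
        = (\<Sum>l\<in>K. t l * (\<alpha> * (c * fst z l - cnj s * snd z l) + \<beta> * (s * fst z l + cnj c * snd z l)))" for z
      by (intro sum.cong) (auto simp: rot_vec_def)
    from alt show ?thesis
    proof
      assume "\<forall>p q. \<alpha> * (c * p - cnj s * q) + \<beta> * (s * p + cnj c * q) = r * p"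
      then have "I \<alpha> \<beta> (rot_vec K c s z) = I r 0 z" for z
        unfolding I_def qr lr by simp
      then show ?thesis by (simp add: prod)
    next
      assume "\<forall>p q. \<alpha> * (c * p - cnj s * q) + \<beta> * (s * p + cnj c * q) = r * q"
      then have "I \<alpha> \<beta> (rot_vec K c s z) = I 0 r z" for z
        unfolding I_def qr lr by simp
      then show ?thesis by (simp add: prod mult.commute)
    qed
  qed
  finally show ?thesis by (simp add: prod r_def)
qed simp

text \<open>
  Writing the Gaussian factor as the characteristic function of a second row makes the integral
  symmetric in the two rows.
\<close>

lemma osc_int_swap:
  assumes K: "finite K" and sym: "\<And>k l. k \<in> K \<Longrightarrow> l \<in> K \<Longrightarrow> \<tau> k l = \<tau> l k"
  shows "osc_int K \<tau> t 0 \<beta> = osc_int K \<tau> t \<beta> 0"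
proof -
  interpret prob_space "cgauss_vec K" by (rule prob_space_cgauss_vec)
  interpret P: pair_prob_space "cgauss_vec K" "cgauss_vec K" ..
  define w where "w = (\<lambda>k. \<beta> * t k)"
  define A where "A = (\<lambda>x y. cis (Re (\<Sum>k\<in>K. ((\<Sum>l\<in>K. \<tau> k l * x l) + w k) * y k)))"
  \<comment> \<open>Symmetry of \<open>\<tau>\<close> makes the phase, which is affine in
    \<open>y\<close> for fixed \<open>x\<close>, also affine in \<open>x\<close> for fixed
    \<open>y\<close>, with coefficients \<open>\<tau>\<close> applied to \<open>y\<close>.
    Integrating out \<open>x\<close> instead of \<open>y\<close> therefore gives the same kind of
    Gaussian factor.\<close>
  have A2: "A x y = cis (Re (\<Sum>k\<in>K. w k * y k)) * cis (Re (\<Sum>l\<in>K. (\<Sum>k\<in>K. \<tau> l k * y k) * x l))" for x y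
  proof -
    have "(\<Sum>k\<in>K. ((\<Sum>l\<in>K. \<tau> k l * x l) + w k) * y k)
        = (\<Sum>k\<in>K. w k * y k) + (\<Sum>k\<in>K. \<Sum>l\<in>K. \<tau> k l * y k * x l)"
      by (simp add: sum.distrib sum_distrib_left sum_distrib_right algebra_simps)
    also have "(\<Sum>k\<in>K. \<Sum>l\<in>K. \<tau> k l * y k * x l) = (\<Sum>l\<in>K. (\<Sum>k\<in>K. \<tau> l k * y k) * x l)"
      by (subst sum.swap) (auto simp: sum_distrib_right sym intro!: sum.cong)
    finally show ?thesis by (simp only: A_def cis_Re_add)
  qed
  have int: "integrable (cgauss_vec K \<Otimes>\<^sub>M cgauss_vec K) (\<lambda>(x, y). A x y)"
    by (rule P.integrable_const_bound[of _ 1]) (auto simp: A_def)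
  have "osc_int K \<tau> t 0 \<beta> = (LINT x|cgauss_vec K. LINT y|cgauss_vec K. A x y)"
    unfolding osc_int_def A_def w_def char_cgauss_vec[OF K] qform_def by simp
  also have "\<dots> = (LINT y|cgauss_vec K. LINT x|cgauss_vec K. A x y)"
    by (rule P.Fubini_integral[symmetric]) (use int in simp)
  also have "\<dots> = (LINT y|cgauss_vec K. cis (Re (\<Sum>k\<in>K. w k * y k)) * (LINT x|cgauss_vec K. cis (Re (\<Sum>l\<in>K. (\<Sum>k\<in>K. \<tau> l k * y k) * x l))))"
    unfolding A2 by simp
  also have "\<dots> = osc_int K \<tau> t \<beta> 0"
    unfolding osc_int_def char_cgauss_vec[OF K] qform_def w_def by (simp add: mult.commute)
  finally show ?thesis .
qed

text \<open>
  The squared modulus is an integral over two copies; passing to \<open>(x + x') / \<surd>2\<close> and \<open>(x' - x) / \<surd>2\<close>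
  separates the two linear parts.
\<close>

lemma osc_int_norm_square:
  fixes \<alpha> \<beta> :: complex
  assumes K: "finite K" and sym: "\<And>k l. k \<in> K \<Longrightarrow> l \<in> K \<Longrightarrow> \<tau> k l = \<tau> l k"
  shows "of_real ((cmod (osc_int K \<tau> t \<alpha> \<beta>))\<^sup>2) = osc_int K \<tau> t (sqrt 2 * \<alpha>) 0 * osc_int K \<tau> t (sqrt 2 * \<beta>) 0"
proof -
  define q where "q = qform K \<tau> (\<lambda>k. \<beta> * t k)"
  define f where "f = (\<lambda>x. complex_of_real (exp (- q x / 4)) * cis (Re (\<Sum>l\<in>K. \<alpha> * t l * x l)))"
  define J where "J = (\<lambda>z. f (fst z) * cnj (f (snd z)))"
  have [measurable]: "q \<in> borel_measurable (cgauss_vec K)" by (simp add: q_def)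
  have [measurable]: "f \<in> borel_measurable (cgauss_vec K)"
    unfolding f_def by measurable
  have [measurable]: "(\<lambda>x. cnj (f x)) \<in> borel_measurable (cgauss_vec K)"
    by (rule borel_measurable_continuous_on[OF _ \<open>f \<in> borel_measurable (cgauss_vec K)\<close>]) (intro continuous_intros)
  have fb: "cmod (f x) \<le> 1" for x by (simp add: f_def norm_mult q_def qform_nonneg)
  have [measurable]: "J \<in> borel_measurable (cgauss_vec K \<Otimes>\<^sub>M cgauss_vec K)"
    unfolding J_def by measurable
  have "of_real ((cmod (osc_int K \<tau> t \<alpha> \<beta>))\<^sup>2) = (LINT x|cgauss_vec K. f x) * cnj (LINT x|cgauss_vec K. f x)"
    unfolding complex_norm_square by (simp add: osc_int_def f_def q_def)
  also have "\<dots> = (LINT z|(cgauss_vec K \<Otimes>\<^sub>M cgauss_vec K). J z)"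
    unfolding J_def by (subst cgauss_vec_pair_integral_mult) (auto simp: fb)
  also have "\<dots> = (LINT z|(cgauss_vec K \<Otimes>\<^sub>M cgauss_vec K). J (rot_vec K (1 / sqrt 2) (- 1 / sqrt 2) z))"
    by (rule integral_rot_vec[symmetric, OF K]) (auto simp: norm_divide power_divide)
  also have "\<dots> = (LINT z|(cgauss_vec K \<Otimes>\<^sub>M cgauss_vec K).
     (of_real (exp (- qform K \<tau> (\<lambda>_. 0) (fst z) / 4)) * cis (Re (\<Sum>l\<in>K. sqrt 2 * \<alpha> * t l * fst z l))) *
     of_real (exp (- qform K \<tau> (\<lambda>k. sqrt 2 * (\<beta> * t k)) (snd z) / 4)))"
  proof (rule arg_cong[where f="integral\<^sup>L _"], rule ext)
    fix z :: "('a \<Rightarrow> complex) \<times> ('a \<Rightarrow> complex)"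
    define x y where "x = fst z" and "y = snd z"
    define X where "X = fst (rot_vec K (1 / sqrt 2) (- 1 / sqrt 2) z)"
    define Y where "Y = snd (rot_vec K (1 / sqrt 2) (- 1 / sqrt 2) z)"
    have X: "X k = (x k + y k) / sqrt 2" and Y: "Y k = (y k - x k) / sqrt 2" if "k \<in> K" for k
      using that by (auto simp: X_def Y_def rot_vec_def x_def y_def field_simps)
    have "q X + q Y = q (\<lambda>k. (x k + y k) / sqrt 2) + q (\<lambda>k. (y k - x k) / sqrt 2)"
      unfolding q_def by (intro arg_cong2[where f="(+)"] qform_cong) (auto simp: X Y)
    also have "\<dots> = qform K \<tau> (\<lambda>_. 0) x + qform K \<tau> (\<lambda>k. sqrt 2 * (\<beta> * t k)) y"
      unfolding q_def by (rule qform_rotate_quarter)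
    finally have q: "q X + q Y = qform K \<tau> (\<lambda>_. 0) x + qform K \<tau> (\<lambda>k. sqrt 2 * (\<beta> * t k)) y" .
    \<comment> \<open>Conjugation subtracts the phase of the second copy, and in
      \<open>X - Y\<close> only \<open>x\<close> survives. So \<open>x\<close> carries the
      oscillation and \<open>y\<close> the shift.\<close>
    have "X l - Y l = sqrt 2 * x l" if "l \<in> K" for l
      using that by (simp add: X Y field_simps of_real_mult[symmetric] del: of_real_mult)
    then have "(\<Sum>l\<in>K. \<alpha> * t l * X l) - (\<Sum>l\<in>K. \<alpha> * t l * Y l) = (\<Sum>l\<in>K. sqrt 2 * \<alpha> * t l * x l)"
      unfolding sum_subtractf[symmetric] right_diff_distrib[symmetric] by (simp add: mult_ac)
    then have l: "Re (\<Sum>l\<in>K. sqrt 2 * \<alpha> * t l * x l) = Re (\<Sum>l\<in>K. \<alpha> * t l * X l) + - Re (\<Sum>l\<in>K. \<alpha> * t l * Y l)"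
      by (metis minus_complex.sel(1) diff_conv_add_uminus)
    have "f X * cnj (f Y) = of_real (exp (- (q X + q Y) / 4)) * cis (Re (\<Sum>l\<in>K. \<alpha> * t l * X l) + - Re (\<Sum>l\<in>K. \<alpha> * t l * Y l))"
      unfolding f_def exp_neg_quarter_add cis_mult[symmetric]
      by (simp only: complex_cnj_mult cis_cnj complex_cnj_complex_of_real of_real_mult mult_ac)
    then show "J (rot_vec K (1 / sqrt 2) (- 1 / sqrt 2) z) =
       (of_real (exp (- qform K \<tau> (\<lambda>_. 0) (fst z) / 4)) * cis (Re (\<Sum>l\<in>K. sqrt 2 * \<alpha> * t l * fst z l))) *
       of_real (exp (- qform K \<tau> (\<lambda>k. sqrt 2 * (\<beta> * t k)) (snd z) / 4))"
      unfolding J_def X_def[symmetric] Y_def[symmetric] x_def[symmetric] y_def[symmetric] l[symmetric] q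
      by (simp only: exp_neg_quarter_add of_real_mult mult_ac)
  qed
  also have "\<dots> = osc_int K \<tau> t (sqrt 2 * \<alpha>) 0 * osc_int K \<tau> t 0 (sqrt 2 * \<beta>)"
    by (subst cgauss_vec_pair_integral_mult) (auto simp: osc_int_def norm_mult qform_nonneg mult_ac)
  \<comment> \<open>Turning the shift back into an oscillation gives both factors the form required
    by \<open>osc_int_mult\<close>.\<close>
  also have "osc_int K \<tau> t 0 (sqrt 2 * \<beta>) = osc_int K \<tau> t (sqrt 2 * \<beta>) 0"
    by (rule osc_int_swap[OF K sym])
  finally show ?thesis .
qed

text \<open>The integrand is strictly positive; the value serves as a divisor later.\<close>

lemma osc_int_zero_pos: "\<exists>a>0. osc_int K \<tau> t 0 0 = of_real a"
proof -
  interpret prob_space "cgauss_vec K" by (rule prob_space_cgauss_vec)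
  define e where "e = (\<lambda>x. exp (- qform K \<tau> (\<lambda>_. 0) x / 4))"
  have [measurable]: "e \<in> borel_measurable (cgauss_vec K)" unfolding e_def by measurable
  have int: "integrable (cgauss_vec K) e"
    by (rule integrable_const_bound[of _ 1]) (auto simp: e_def qform_nonneg)
  have "0 < (LINT x|cgauss_vec K. e x)"
    using integral_less_AE_space[of "\<lambda>_. 0" e] int emeasure_space_1 by (simp add: e_def)
  moreover have "osc_int K \<tau> t 0 0 = of_real (LINT x|cgauss_vec K. e x)"
    by (simp add: osc_int_def e_def)
  ultimately show ?thesis by blast
qed

text \<open>Let \<open>\<psi> r\<close> be the right-hand side. The squared modulus is the product
  of the values at \<open>sqrt 2 * \<alpha>\<close> and \<open>sqrt 2 * \<beta>\<close>, which
  \<open>osc_int_mult\<close> turns into \<open>\<psi> (sqrt 2 * r) * a\<close>, and likewise this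
  equals \<open>\<psi> r * \<psi> r\<close>. So the modulus is \<open>\<psi> r\<close> up to
  sign.\<close>

lemma osc_int_norm:
  assumes K: "finite K" and sym: "\<And>k l. k \<in> K \<Longrightarrow> l \<in> K \<Longrightarrow> \<tau> k l = \<tau> l k"
  shows "of_real (cmod (osc_int K \<tau> t \<alpha> \<beta>)) = osc_int K \<tau> t (of_real (sqrt ((cmod \<alpha>)\<^sup>2 + (cmod \<beta>)\<^sup>2))) 0"
proof -
  define r where "r = sqrt ((cmod \<alpha>)\<^sup>2 + (cmod \<beta>)\<^sup>2)"
  define \<psi> where "\<psi> = (\<lambda>s::real. osc_int K \<tau> t (of_real s) 0)"
  obtain a where a: "a > 0" "osc_int K \<tau> t 0 0 = of_real a" using osc_int_zero_pos by blast
  have r0: "r \<ge> 0" by (simp add: r_def)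
  have eq: "sqrt ((cmod (of_real r))\<^sup>2 + (cmod (of_real r))\<^sup>2) = sqrt 2 * r"
    "sqrt ((cmod (sqrt 2 * \<alpha>))\<^sup>2 + (cmod (sqrt 2 * \<beta>))\<^sup>2) = sqrt 2 * r"
  proof -
    have "(cmod (of_real r))\<^sup>2 + (cmod (of_real r))\<^sup>2 = 2 * r\<^sup>2" by simp
    then show "sqrt ((cmod (of_real r))\<^sup>2 + (cmod (of_real r))\<^sup>2) = sqrt 2 * r"
      using r0 by (simp add: real_sqrt_mult)
    have "(cmod (sqrt 2 * \<alpha>))\<^sup>2 + (cmod (sqrt 2 * \<beta>))\<^sup>2 = 2 * ((cmod \<alpha>)\<^sup>2 + (cmod \<beta>)\<^sup>2)"
      by (simp add: norm_mult power_mult_distrib)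
    then show "sqrt ((cmod (sqrt 2 * \<alpha>))\<^sup>2 + (cmod (sqrt 2 * \<beta>))\<^sup>2) = sqrt 2 * r"
      by (simp only: real_sqrt_mult r_def)
  qed
  have sq: "\<psi> r * \<psi> r = \<psi> (sqrt 2 * r) * of_real a"
    using osc_int_mult[OF K, of \<tau> t "of_real r" "of_real r"] unfolding \<psi>_def eq a(2) .
  have "of_real ((cmod (osc_int K \<tau> t \<alpha> \<beta>))\<^sup>2) = \<psi> (sqrt 2 * r) * of_real a"
    using osc_int_norm_square[where \<tau>=\<tau> and t=t and \<alpha>=\<alpha> and \<beta>=\<beta>, OF K sym] osc_int_mult[OF K, of \<tau> t "sqrt 2 * \<alpha>" "sqrt 2 * \<beta>"]
    unfolding eq a(2) \<psi>_def by simp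
  with sq have *: "\<psi> r * \<psi> r = of_real ((cmod (osc_int K \<tau> t \<alpha> \<beta>))\<^sup>2)" by simp
  \<comment> \<open>Fixes the sign: the squared modulus at \<open>r / sqrt 2\<close> with zero shift
    is \<open>\<psi> r * a\<close>, so \<open>\<psi> r\<close> is real and nonnegative.\<close>
  have "of_real ((cmod (\<psi> (r / sqrt 2)))\<^sup>2) = \<psi> r * of_real a"
    using osc_int_norm_square[where \<tau>=\<tau> and t=t and \<alpha>="of_real (r / sqrt 2)" and \<beta>=0, OF K sym] a(2) by (simp add: \<psi>_def)
  then have "\<psi> r = of_real ((cmod (\<psi> (r / sqrt 2)))\<^sup>2 / a)"
    using a(1) by (simp add: field_simps)
  then obtain b where b: "b \<ge> 0" "\<psi> r = of_real b" using a(1) by (metis divide_nonneg_pos zero_le_power2)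
  have "b\<^sup>2 = (cmod (osc_int K \<tau> t \<alpha> \<beta>))\<^sup>2"
    using * unfolding b(2) of_real_mult[symmetric] of_real_eq_iff by (simp add: power2_eq_square)
  then have "b = cmod (osc_int K \<tau> t \<alpha> \<beta>)" using b(1) by simp
  then show ?thesis using b(2) by (simp add: \<psi>_def r_def)
qed

section \<open>Hafnians and row expansion\<close>

definition edges :: "nat set \<Rightarrow> (nat \<times> nat) set" where
  "edges W = {(i, j). i \<in> W \<and> j \<in> W \<and> i < j}"

lemma finite_edges: "finite W \<Longrightarrow> finite (edges W)"
  by (rule finite_subset[of _ "W \<times> W"]) (auto simp: edges_def)

text \<open>The hafnian on an arbitrary vertex set, with weights indexed by increasing pairs, so
  that minors are hafnians of subsets and the Gaussian weights can live on
  \<open>edges\<close>.\<close>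

definition haf :: "nat set \<Rightarrow> (nat \<times> nat \<Rightarrow> complex) \<Rightarrow> complex" where
  "haf V w = (\<Sum>P\<in>perfect_matchings V. \<Prod>e\<in>P. w (Min e, Max e))"

lemma finite_perfect_matchings: "finite V \<Longrightarrow> finite (perfect_matchings V)"
  by (rule finite_subset[of _ "Pow (Pow V)"]) (auto simp: perfect_matchings_def partition_on_def)

lemma perfect_matchings_empty: "perfect_matchings {} = {{}}"
  by (auto simp: perfect_matchings_def partition_on_def)

lemma haf_empty [simp]: "haf {} w = 1"
  by (simp add: haf_def perfect_matchings_empty)

lemma matching_edge:
  assumes "finite V" "P \<in> perfect_matchings V" "e \<in> P"
  shows "(Min e, Max e) \<in> edges V"
proof -
  have "e \<subseteq> V" "card e = 2" using assms by (auto simp: perfect_matchings_def partition_on_def)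
  moreover from this obtain a b where "e = {a, b}" "a \<noteq> b" by (auto simp: card_2_iff)
  ultimately show ?thesis by (auto simp: edges_def min_def max_def)
qed

lemma haf_cong:
  assumes "finite V" "\<And>e. e \<in> edges V \<Longrightarrow> w e = w' e"
  shows "haf V w = haf V w'"
  unfolding haf_def by (intro sum.cong prod.cong refl assms(2) matching_edge[OF assms(1)])

lemma insert_perfect_matching:
  assumes "c \<notin> V" "b \<in> V" "P \<in> perfect_matchings (V - {b})"
  shows "insert {c, b} P \<in> perfect_matchings (insert c V)" "{c, b} \<notin> P"
proof -
  have U: "\<Union>P = V - {b}" and D: "disjoint P" and E: "{} \<notin> P" and C: "\<forall>e\<in>P. card e = 2"
    using assms(3) by (auto simp: perfect_matchings_def partition_on_def)
  have "c \<noteq> b" using assms(1,2) by auto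
  then have cb: "card {c, b} = 2" by simp
  have dis: "e \<inter> {c, b} = {}" if "e \<in> P" for e using that U assms by blast
  then show "{c, b} \<notin> P" by blast
  have "disjoint (insert {c, b} P)"
    using D dis unfolding disjoint_def by (metis Int_commute insert_iff)
  then show "insert {c, b} P \<in> perfect_matchings (insert c V)"
    using U E C cb assms by (auto simp: perfect_matchings_def partition_on_def)
qed

lemma perfect_matching_remove:
  assumes P: "P \<in> perfect_matchings (insert c V)" and c: "c \<notin> V"
  obtains b P' where "b \<in> V" "P' \<in> perfect_matchings (V - {b})" "P = insert {c, b} P'"
proof -
  have U: "\<Union>P = insert c V" and D: "disjoint P" and E: "{} \<notin> P" and C: "\<forall>e\<in>P. card e = 2"
    using P by (auto simp: perfect_matchings_def partition_on_def)
  obtain e where e: "e \<in> P" "c \<in> e" using U by auto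
  then obtain b where b: "e = {c, b}" "b \<noteq> c"
  proof -
    obtain x y where "e = {x, y}" "x \<noteq> y" using C e(1) by (metis card_2_iff)
    then show thesis using e(2) that by (cases "x = c") auto
  qed
  have bV: "b \<in> V" using e b U by auto
  have dis: "f \<inter> e = {}" if "f \<in> P - {e}" for f
    using D e(1) that by (auto simp: disjoint_def)
  have "\<Union>(P - {e}) = \<Union>P - e"
    using dis e(1) by auto
  also have "\<dots> = V - {b}" using U b c by auto
  finally have "P - {e} \<in> perfect_matchings (V - {b})"
    using D E C by (auto simp: perfect_matchings_def partition_on_def disjoint_def)
  moreover have "P = insert {c, b} (P - {e})" using e b by auto
  ultimately show thesis using that bV by blast
qed

text \<open>A perfect matching of \<open>insert c V\<close> amounts to a partner \<open>b\<close> of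
  \<open>c\<close> and a perfect matching of \<open>V - {b}\<close>; \<open>h\<close> is this
  bijection.\<close>

lemma haf_insert:
  assumes V: "finite V" and c: "c \<notin> V"
  shows "haf (insert c V) w = (\<Sum>b\<in>V. w (min c b, max c b) * haf (V - {b}) w)"
proof -
  define S where "S = (SIGMA b:V. perfect_matchings (V - {b}))"
  define h where "h = (\<lambda>(b, P). insert {c, b} P)"
  have inj: "inj_on h S"
  proof (rule inj_onI, clarify)
    fix b P b' P' assume S: "(b, P) \<in> S" "(b', P') \<in> S" and eq: "h (b, P) = h (b', P')"
    have no: "c \<notin> e" if "e \<in> P \<or> e \<in> P'" for e
      using that S c by (auto simp: S_def perfect_matchings_def partition_on_def)
    have "{c, b} \<in> insert {c, b'} P'" using eq by (auto simp: h_def)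
    then have "{c, b} = {c, b'}" using no by auto
    then have "b = b'" using S c by (auto simp: S_def doubleton_eq_iff)
    moreover have "P = P'"
      using eq \<open>b = b'\<close> no by (auto simp: h_def)
    ultimately show "b = b' \<and> P = P'" by simp
  qed
  have im: "h ` S = perfect_matchings (insert c V)"
  proof
    show "h ` S \<subseteq> perfect_matchings (insert c V)"
      using insert_perfect_matching(1)[OF c] by (auto simp: h_def S_def)
    show "perfect_matchings (insert c V) \<subseteq> h ` S"
    proof
      fix P assume "P \<in> perfect_matchings (insert c V)"
      then obtain b P' where "b \<in> V" "P' \<in> perfect_matchings (V - {b})" "P = insert {c, b} P'"
        by (rule perfect_matching_remove[OF _ c])
      then have "(b, P') \<in> S" "P = h (b, P')" by (auto simp: S_def h_def)
      then show "P \<in> h ` S" by blast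
    qed
  qed
  have fin: "finite (perfect_matchings (V - {b}))" for b
    using V by (simp add: finite_perfect_matchings)
  have "haf (insert c V) w = (\<Sum>z\<in>S. \<Prod>e\<in>h z. w (Min e, Max e))"
    unfolding haf_def im[symmetric] using inj by (simp add: sum.reindex)
  also have "\<dots> = (\<Sum>(b, P)\<in>S. w (min c b, max c b) * (\<Prod>e\<in>P. w (Min e, Max e)))"
  proof (intro sum.cong refl, clarify)
    fix b P assume bP: "(b, P) \<in> S"
    then have "P \<subseteq> Pow V" by (auto simp: S_def perfect_matchings_def partition_on_def)
    then have "finite P" using V by (meson finite_Pow_iff finite_subset)
    then show "(\<Prod>e\<in>h (b, P). w (Min e, Max e)) = w (min c b, max c b) * (\<Prod>e\<in>P. w (Min e, Max e))"
      using bP insert_perfect_matching(2)[OF c, of b P] by (simp add: h_def S_def)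
  qed
  also have "\<dots> = (\<Sum>b\<in>V. \<Sum>P\<in>perfect_matchings (V - {b}). w (min c b, max c b) * (\<Prod>e\<in>P. w (Min e, Max e)))"
    unfolding S_def using V fin by (subst sum.Sigma) auto
  also have "\<dots> = (\<Sum>b\<in>V. w (min c b, max c b) * haf (V - {b}) w)"
    by (simp add: haf_def sum_distrib_left)
  finally show ?thesis .
qed

lemma measurable_haf:
  assumes "finite W" "V \<subseteq> W"
  shows "haf V \<in> borel_measurable (cgauss_vec (edges W))"
proof -
  have "finite V" using assms finite_subset by blast
  have "edges V \<subseteq> edges W" using assms by (auto simp: edges_def)
  then have [measurable]: "(\<lambda>w. w (Min e, Max e)) \<in> borel_measurable (cgauss_vec (edges W))"
    if "P \<in> perfect_matchings V" "e \<in> P" for P e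
    using subsetD[OF \<open>edges V \<subseteq> edges W\<close> matching_edge[OF \<open>finite V\<close> that]] by measurable
  show ?thesis
    unfolding haf_def by (intro borel_measurable_sum borel_measurable_prod) measurable
qed

section \<open>Adding an independent Gaussian row\<close>

definition add_row :: "nat \<Rightarrow> nat set \<Rightarrow> (nat \<Rightarrow> complex) \<times> (nat \<times> nat \<Rightarrow> complex) \<Rightarrow> nat \<times> nat \<Rightarrow> complex" where
  "add_row c W z = (\<lambda>(i, j)\<in>edges (insert c W). if i = c then fst z j else if j = c then fst z i else snd z (i, j))"

lemma haf_add_row:
  assumes "finite W" "c \<notin> W" "D \<subseteq> W"
  shows "haf D (add_row c W z) = haf D (snd z)"
  by (rule haf_cong) (use assms in \<open>auto simp: add_row_def edges_def finite_subset\<close>)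

text \<open>Expansion along the row of \<open>c\<close>. The minors do not involve this row, so the
  hafnian is linear in it.\<close>

lemma haf_add_row_insert:
  assumes W: "finite W" "c \<notin> W" "D \<subseteq> W"
  shows "haf (insert c D) (add_row c W z) = (\<Sum>b\<in>D. fst z b * haf (D - {b}) (snd z))"
proof -
  have D: "finite D" "c \<notin> D" using W finite_subset by blast+
  have "haf (insert c D) (add_row c W z) = (\<Sum>b\<in>D. add_row c W z (min c b, max c b) * haf (D - {b}) (add_row c W z))"
    by (rule haf_insert[OF D])
  also have "\<dots> = (\<Sum>b\<in>D. fst z b * haf (D - {b}) (snd z))"
  proof (intro sum.cong refl arg_cong2[where f="(*)"])
    fix b assume b: "b \<in> D"
    then show "add_row c W z (min c b, max c b) = fst z b"
      using W D by (auto simp: add_row_def edges_def min_def max_def)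
    show "haf (D - {b}) (add_row c W z) = haf (D - {b}) (snd z)"
      using W by (intro haf_add_row) auto
  qed
  finally show ?thesis .
qed

lemma measurable_add_row:
  assumes "c \<notin> W"
  shows "add_row c W \<in> measurable (cgauss_vec W \<Otimes>\<^sub>M cgauss_vec (edges W)) (cgauss_vec (edges (insert c W)))"
proof -
  have "(\<lambda>z. if fst e = c then fst z (snd e) else if snd e = c then fst z (fst e) else snd z e)
     \<in> borel_measurable (cgauss_vec W \<Otimes>\<^sub>M cgauss_vec (edges W))" if e: "e \<in> edges (insert c W)" for e
  proof -
    consider "fst e = c" "snd e \<in> W" | "fst e \<noteq> c" "snd e = c" "fst e \<in> W" | "fst e \<noteq> c" "snd e \<noteq> c" "e \<in> edges W"
      using e by (cases e) (auto simp: edges_def)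
    then show ?thesis by cases (simp_all, measurable)
  qed
  then have "(\<lambda>z. \<lambda>e\<in>edges (insert c W). if fst e = c then fst z (snd e) else if snd e = c then fst z (fst e) else snd z e)
     \<in> measurable (cgauss_vec W \<Otimes>\<^sub>M cgauss_vec (edges W)) (cgauss_vec (edges (insert c W)))"
    unfolding measurable_cong_sets[OF refl sets_cgauss, symmetric] by (rule measurable_restrict)
  then show ?thesis
    unfolding add_row_def case_prod_beta prod.collapse .
qed

text \<open>The edges of \<open>insert c W\<close> split disjointly into the star at
  \<open>c\<close>, enumerated by \<open>m\<close>, and the edges of \<open>W\<close>. Hence the
  preimage of a box is a product of boxes and its measure factors.\<close>

lemma distr_add_row:
  assumes W: "finite W" "c \<notin> W"
  shows "distr (cgauss_vec W \<Otimes>\<^sub>M cgauss_vec (edges W)) (cgauss_vec (edges (insert c W))) (add_row c W) = cgauss_vec (edges (insert c W))"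
proof (rule cgauss_prod.PiM_eqI)
  interpret G: prob_space "cgauss_vec W" by (rule prob_space_cgauss_vec)
  interpret H: prob_space "cgauss_vec (edges W)" by (rule prob_space_cgauss_vec)
  show "finite (edges (insert c W))" using W by (simp add: finite_edges)
  fix A :: "nat \<times> nat \<Rightarrow> complex set"
  assume A: "\<And>e. e \<in> edges (insert c W) \<Longrightarrow> A e \<in> sets cgauss"
  define m where "m = (\<lambda>b. (min c b, max c b))"
  have m_in: "m b \<in> edges (insert c W)" if "b \<in> W" for b
    using that W by (cases "c = b") (auto simp: m_def edges_def min_def max_def)
  have inj: "inj_on m W" by (auto simp: inj_on_def m_def min_def max_def split: if_splits)
  have eq: "edges (insert c W) = m ` W \<union> edges W"
  proof
    show "edges (insert c W) \<subseteq> m ` W \<union> edges W"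
    proof
      fix e assume "e \<in> edges (insert c W)"
      then obtain i j where e: "e = (i, j)" "i \<in> insert c W" "j \<in> insert c W" "i < j" by (auto simp: edges_def)
      then consider "i = c" "j \<in> W" | "j = c" "i \<in> W" | "i \<in> W" "j \<in> W" by auto
      then show "e \<in> m ` W \<union> edges W"
      proof cases
        case 1
        then have "e = m j" using e by (simp add: m_def)
        then show ?thesis using 1 by blast
      next
        case 2
        then have "e = m i" using e by (simp add: m_def)
        then show ?thesis using 2 by blast
      next
        case 3
        then show ?thesis using e by (simp add: edges_def)
      qed
    qed
    show "m ` W \<union> edges W \<subseteq> edges (insert c W)"
      using m_in by (auto simp: subset_eq) (auto simp: edges_def)
  qed
  have disj: "m ` W \<inter> edges W = {}"
    using W by (auto simp: m_def edges_def min_def max_def split: if_splits)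
  have A1: "Pi\<^sub>E W (\<lambda>b. A (m b)) \<in> sets (cgauss_vec W)"
    using W m_in A by (intro sets_PiM_I_finite) auto
  have A2: "Pi\<^sub>E (edges W) A \<in> sets (cgauss_vec (edges W))"
    using W A eq by (intro sets_PiM_I_finite) (auto simp: finite_edges)
  have "add_row c W -` (Pi\<^sub>E (edges (insert c W)) A) \<inter> space (cgauss_vec W \<Otimes>\<^sub>M cgauss_vec (edges W))
      = Pi\<^sub>E W (\<lambda>b. A (m b)) \<times> Pi\<^sub>E (edges W) A"
  proof (intro set_eqI iffI)
    fix z assume z: "z \<in> add_row c W -` (Pi\<^sub>E (edges (insert c W)) A) \<inter> space (cgauss_vec W \<Otimes>\<^sub>M cgauss_vec (edges W))"
    have J: "add_row c W z e \<in> A e" if "e \<in> edges (insert c W)" for e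
      using z that by auto
    have "fst z b \<in> A (m b)" if "b \<in> W" for b
      using J[OF m_in[OF that]] m_in[OF that] that W by (auto simp: add_row_def m_def min_def max_def split: if_splits)
    moreover have "snd z e \<in> A e" if "e \<in> edges W" for e
    proof -
      have "e \<in> edges (insert c W)" using that eq by auto
      with J[OF this] show ?thesis using that W by (auto simp: add_row_def edges_def split: if_splits)
    qed
    ultimately show "z \<in> Pi\<^sub>E W (\<lambda>b. A (m b)) \<times> Pi\<^sub>E (edges W) A"
      using z by (auto simp: space_pair_measure space_PiM PiE_def Pi_def mem_Times_iff)
  next
    fix z assume z: "z \<in> Pi\<^sub>E W (\<lambda>b. A (m b)) \<times> Pi\<^sub>E (edges W) A"
    have "add_row c W z e \<in> A e" if "e \<in> edges (insert c W)" for e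
    proof -
      from that eq consider b where "b \<in> W" "e = m b" | "e \<in> edges W" by auto
      then show ?thesis
      proof cases
        case 1
        then have "add_row c W z e = fst z b"
          using W m_in[OF 1(1)] by (auto simp: add_row_def m_def min_def max_def)
        then show ?thesis using 1 z by auto
      next
        case 2
        then have "add_row c W z e = snd z e"
          using W that by (auto simp: add_row_def edges_def)
        then show ?thesis using 2 z by auto
      qed
    qed
    then have "add_row c W z \<in> Pi\<^sub>E (edges (insert c W)) A"
      by (auto simp: add_row_def)
    then show "z \<in> add_row c W -` (Pi\<^sub>E (edges (insert c W)) A) \<inter> space (cgauss_vec W \<Otimes>\<^sub>M cgauss_vec (edges W))"
      using z by (auto simp: space_pair_measure space_PiM mem_Times_iff PiE_def)
  qed
  then have "emeasure (distr (cgauss_vec W \<Otimes>\<^sub>M cgauss_vec (edges W)) (cgauss_vec (edges (insert c W))) (add_row c W)) (Pi\<^sub>E (edges (insert c W)) A)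
      = emeasure (cgauss_vec W \<Otimes>\<^sub>M cgauss_vec (edges W)) (Pi\<^sub>E W (\<lambda>b. A (m b)) \<times> Pi\<^sub>E (edges W) A)"
    using W A by (subst emeasure_distr[OF measurable_add_row[OF W(2)]])
      (auto intro!: sets_PiM_I_finite simp: finite_edges)
  also have "\<dots> = (\<Prod>b\<in>W. emeasure cgauss (A (m b))) * (\<Prod>e\<in>edges W. emeasure cgauss (A e))"
  proof -
    have "emeasure (cgauss_vec W) (Pi\<^sub>E W (\<lambda>b. A (m b))) = (\<Prod>b\<in>W. emeasure cgauss (A (m b)))"
      using W m_in A by (intro cgauss_prod.emeasure_PiM) auto
    moreover have "emeasure (cgauss_vec (edges W)) (Pi\<^sub>E (edges W) A) = (\<Prod>e\<in>edges W. emeasure cgauss (A e))"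
      using W A eq by (intro cgauss_prod.emeasure_PiM) (auto simp: finite_edges)
    ultimately show ?thesis
      by (simp add: H.emeasure_pair_measure_Times[OF A1 A2])
  qed
  also have "\<dots> = (\<Prod>e\<in>m ` W. emeasure cgauss (A e)) * (\<Prod>e\<in>edges W. emeasure cgauss (A e))"
    using inj by (simp add: prod.reindex)
  also have "\<dots> = (\<Prod>e\<in>edges (insert c W). emeasure cgauss (A e))"
    unfolding eq using W disj by (intro prod.union_disjoint[symmetric]) (auto simp: finite_edges)
  finally show "emeasure (distr (cgauss_vec W \<Otimes>\<^sub>M cgauss_vec (edges W)) (cgauss_vec (edges (insert c W))) (add_row c W)) (Pi\<^sub>E (edges (insert c W)) A)
      = (\<Prod>e\<in>edges (insert c W). emeasure cgauss (A e))" .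
qed simp

section \<open>Concentrating the first row in one entry\<close>

lemma prob_space_cgauss_vec_pair: "pair_prob_space (cgauss_vec I) (cgauss_vec J)"
  by (intro pair_prob_space.intro pair_sigma_finite.intro prob_space_imp_sigma_finite prob_space_cgauss_vec)

lemma integral_add_row:
  fixes f :: "(nat \<times> nat \<Rightarrow> complex) \<Rightarrow> complex"
  assumes W: "finite W" "c \<notin> W" and f [measurable]: "f \<in> borel_measurable (cgauss_vec (edges (insert c W)))"
    and b: "\<And>w. cmod (f w) \<le> 1"
  shows "(LINT w|cgauss_vec (edges (insert c W)). f w) = (LINT \<eta>|cgauss_vec (edges W). LINT x|cgauss_vec W. f (add_row c W (x, \<eta>)))"
    and "(LINT w|cgauss_vec (edges (insert c W)). f w) = (LINT x|cgauss_vec W. LINT \<eta>|cgauss_vec (edges W). f (add_row c W (x, \<eta>)))"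
proof -
  interpret P: pair_prob_space "cgauss_vec W" "cgauss_vec (edges W)" by (rule prob_space_cgauss_vec_pair)
  note [measurable] = measurable_add_row[OF W(2)]
  have 0: "integrable (cgauss_vec W \<Otimes>\<^sub>M cgauss_vec (edges W)) (\<lambda>(x, \<eta>). f (add_row c W (x, \<eta>)))"
    using b by (intro P.integrable_const_bound[of _ 1]) auto
  have 1: "(LINT w|cgauss_vec (edges (insert c W)). f w) = (LINT z|(cgauss_vec W \<Otimes>\<^sub>M cgauss_vec (edges W)). f (add_row c W z))"
    by (subst distr_add_row[OF W, symmetric], rule integral_distr) auto
  show "(LINT w|cgauss_vec (edges (insert c W)). f w) = (LINT \<eta>|cgauss_vec (edges W). LINT x|cgauss_vec W. f (add_row c W (x, \<eta>)))"
    using P.integral_snd[OF 0] unfolding 1 by (simp add: case_prod_beta')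
  show "(LINT w|cgauss_vec (edges (insert c W)). f w) = (LINT x|cgauss_vec W. LINT \<eta>|cgauss_vec (edges W). f (add_row c W (x, \<eta>)))"
    using P.integral_fst'[OF 0] unfolding 1 by (simp add: case_prod_beta')
qed

text \<open>The characteristic function at \<open>u\<close> of the random vector of minors
  \<open>haf (X - {b})\<close>, with the bilinear pairing in place of the Hermitian one.\<close>

definition minor_char :: "nat set \<Rightarrow> (nat \<Rightarrow> complex) \<Rightarrow> complex" where
  "minor_char X u = (LINT \<eta>|cgauss_vec (edges X). cis (Re (\<Sum>b\<in>X. u b * haf (X - {b}) \<eta>)))"

definition haf_char :: "nat set \<Rightarrow> complex \<Rightarrow> complex" where
  "haf_char V r = (LINT w|cgauss_vec (edges V). cis (Re (r * haf V w)))"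

text \<open>The conditional variance \<open>S\<^sub>n\<close> of the hafnian of
  \<open>insert c X\<close>, given the matrix on \<open>X\<close>.\<close>

definition minor_norm2 :: "nat set \<Rightarrow> (nat \<times> nat \<Rightarrow> complex) \<Rightarrow> real" where
  "minor_norm2 X \<eta> = (\<Sum>b\<in>X. (cmod (haf (X - {b}) \<eta>))\<^sup>2)"

lemma minor_norm2_nonneg: "minor_norm2 X \<eta> \<ge> 0"
  by (simp add: minor_norm2_def sum_nonneg)

lemma measurable_minor_norm2 [measurable]:
  assumes "finite X"
  shows "minor_norm2 X \<in> borel_measurable (cgauss_vec (edges X))"
proof -
  have [measurable]: "haf (X - {b}) \<in> borel_measurable (cgauss_vec (edges X))" for b
    using assms by (intro measurable_haf) auto
  show ?thesis unfolding minor_norm2_def by measurable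
qed

text \<open>Fubini in both orders. Integrating the row of \<open>c\<close> first leaves a Gaussian
  factor with variance \<open>minor_norm2\<close>; integrating the matrix first leaves an average of
  \<open>minor_char\<close> over a Gaussian row.\<close>

lemma haf_char_insert:
  assumes X: "finite X" "c \<notin> X"
  shows "haf_char (insert c X) r = (LINT \<eta>|cgauss_vec (edges X). of_real (exp (- (cmod r)\<^sup>2 * minor_norm2 X \<eta> / 4)))"
    and "haf_char (insert c X) r = (LINT x|cgauss_vec X. minor_char X (\<lambda>b. r * x b))"
proof -
  have [measurable]: "haf (insert c X) \<in> borel_measurable (cgauss_vec (edges (insert c X)))"
    using X by (intro measurable_haf) auto
  have eq: "r * haf (insert c X) (add_row c X (x, \<eta>)) = (\<Sum>b\<in>X. r * x b * haf (X - {b}) \<eta>)" for x \<eta>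
    by (simp add: haf_add_row_insert[OF X] sum_distrib_left mult.assoc)
  have eq': "r * haf (insert c X) (add_row c X (x, \<eta>)) = (\<Sum>b\<in>X. (r * haf (X - {b}) \<eta>) * x b)" for x \<eta>
    unfolding eq by (simp add: mult_ac)
  have "haf_char (insert c X) r = (LINT \<eta>|cgauss_vec (edges X). LINT x|cgauss_vec X. cis (Re (\<Sum>b\<in>X. (r * haf (X - {b}) \<eta>) * x b)))"
    unfolding haf_char_def by (subst integral_add_row(1)[OF X]) (auto simp: eq')
  also have "\<dots> = (LINT \<eta>|cgauss_vec (edges X). of_real (exp (- (cmod r)\<^sup>2 * minor_norm2 X \<eta> / 4)))"
    unfolding char_cgauss_vec[OF X(1)] minor_norm2_def norm_mult power_mult_distrib sum_distrib_left[symmetric]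
    by (simp only: mult_minus_left)
  finally show "haf_char (insert c X) r = (LINT \<eta>|cgauss_vec (edges X). of_real (exp (- (cmod r)\<^sup>2 * minor_norm2 X \<eta> / 4)))" .
  show "haf_char (insert c X) r = (LINT x|cgauss_vec X. minor_char X (\<lambda>b. r * x b))"
    unfolding haf_char_def minor_char_def by (subst integral_add_row(2)[OF X]) (auto simp: eq)
qed

text \<open>Integrates out the row of \<open>d\<close>. The minor without \<open>d\<close> does not
  contain that row, and every other minor is linear in it, so the Gaussian integral leaves the
  squared coefficients of the entries \<open>x k\<close>.\<close>

lemma minor_char_insert:
  assumes Y: "finite Y" "d \<notin> Y"
  shows "minor_char (insert d Y) u = (LINT \<eta>|cgauss_vec (edges Y).
    cis (Re (u d * haf Y \<eta>)) *
    of_real (exp (- (\<Sum>k\<in>Y. (cmod (\<Sum>b\<in>Y - {k}. u b * haf (Y - {b} - {k}) \<eta>))\<^sup>2) / 4)))"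
proof -
  have [measurable]: "haf (insert d Y - {b}) \<in> borel_measurable (cgauss_vec (edges (insert d Y)))" for b
    using Y by (intro measurable_haf) auto
  have eq: "(\<Sum>b\<in>insert d Y. u b * haf (insert d Y - {b}) (add_row d Y (x, \<eta>)))
    = u d * haf Y \<eta> + (\<Sum>k\<in>Y. (\<Sum>b\<in>Y - {k}. u b * haf (Y - {b} - {k}) \<eta>) * x k)" for x \<eta>
  proof -
    have "(\<Sum>b\<in>insert d Y. u b * haf (insert d Y - {b}) (add_row d Y (x, \<eta>)))
      = u d * haf (insert d Y - {d}) (add_row d Y (x, \<eta>)) + (\<Sum>b\<in>Y. u b * haf (insert d Y - {b}) (add_row d Y (x, \<eta>)))"
      using Y by simp
    also have "haf (insert d Y - {d}) (add_row d Y (x, \<eta>)) = haf Y \<eta>"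
      using Y haf_add_row[OF Y, of Y "(x, \<eta>)"] by simp
    also have "(\<Sum>b\<in>Y. u b * haf (insert d Y - {b}) (add_row d Y (x, \<eta>)))
       = (\<Sum>b\<in>Y. \<Sum>k\<in>Y - {b}. u b * haf (Y - {b} - {k}) \<eta> * x k)"
    proof (rule sum.cong[OF refl])
      fix b assume "b \<in> Y"
      then have "insert d Y - {b} = insert d (Y - {b})" using Y by auto
      then show "u b * haf (insert d Y - {b}) (add_row d Y (x, \<eta>)) = (\<Sum>k\<in>Y - {b}. u b * haf (Y - {b} - {k}) \<eta> * x k)"
        using haf_add_row_insert[OF Y, of "Y - {b}" "(x, \<eta>)"] by (simp add: sum_distrib_left mult_ac)
    qed
    also have "\<dots> = (\<Sum>k\<in>Y. \<Sum>b\<in>Y - {k}. u b * haf (Y - {b} - {k}) \<eta> * x k)"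
    proof -
      have "(\<Sum>b\<in>Y. \<Sum>k\<in>Y - {b}. u b * haf (Y - {b} - {k}) \<eta> * x k)
          = (\<Sum>b\<in>Y. \<Sum>k | k \<in> Y \<and> b \<noteq> k. u b * haf (Y - {b} - {k}) \<eta> * x k)"
        by (intro sum.cong) auto
      also have "\<dots> = (\<Sum>k\<in>Y. \<Sum>b | b \<in> Y \<and> b \<noteq> k. u b * haf (Y - {b} - {k}) \<eta> * x k)"
        by (rule sum.swap_restrict) (use Y in auto)
      also have "\<dots> = (\<Sum>k\<in>Y. \<Sum>b\<in>Y - {k}. u b * haf (Y - {b} - {k}) \<eta> * x k)"
        by (intro sum.cong) auto
      finally show ?thesis .
    qed
    finally show ?thesis by (simp add: sum_distrib_right)
  qed
  have "minor_char (insert d Y) u = (LINT \<eta>|cgauss_vec (edges Y). LINT x|cgauss_vec Y.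
     cis (Re (u d * haf Y \<eta>)) * cis (Re (\<Sum>k\<in>Y. (\<Sum>b\<in>Y - {k}. u b * haf (Y - {b} - {k}) \<eta>) * x k)))"
    unfolding minor_char_def by (subst integral_add_row(1)[OF Y]) (simp_all only: eq cis_Re_add norm_cis order_refl, measurable)
  then show ?thesis by (simp only: integral_mult_right_zero char_cgauss_vec[OF Y(1)])
qed

text \<open>The end point of the concentration: the one remaining minor does not contain the row of
  \<open>d\<close>, which integrates out trivially.\<close>

lemma minor_char_single:
  assumes "finite X" "d \<in> X" "\<And>b. b \<in> X - {d} \<Longrightarrow> u b = 0"
  shows "minor_char X u = haf_char (X - {d}) (u d)"
proof -
  have X: "X = insert d (X - {d})" using assms by auto
  have "minor_char X u = (LINT \<eta>|cgauss_vec (edges (X - {d})).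
    cis (Re (u d * haf (X - {d}) \<eta>)) *
    of_real (exp (- (\<Sum>k\<in>X - {d}. (cmod (\<Sum>b\<in>X - {d} - {k}. u b * haf (X - {d} - {b} - {k}) \<eta>))\<^sup>2) / 4)))"
    by (subst X, rule minor_char_insert) (use assms in auto)
  then show ?thesis
    using assms by (simp add: haf_char_def)
qed

text \<open>The row of \<open>d\<close> is integrated out and the row \<open>y\<close> of
  \<open>a\<close> made explicit. The coefficient at \<open>a\<close> is free of \<open>y\<close>
  and yields \<open>e\<close>; those at \<open>k\<close> in \<open>K\<close> are affine in
  \<open>y\<close>, with linear part \<open>\<tau>\<close> and shift \<open>u a * t\<close>. The
  diagonal of \<open>\<tau>\<close> vanishes since \<open>a\<close> cannot be matched with the
  removed vertex \<open>k\<close>.\<close>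

lemma minor_char_insert2:
  fixes K :: "nat set"
  assumes K: "finite K" "a \<notin> K" "d \<notin> K" "a \<noteq> d"
  defines "\<tau> \<equiv> \<lambda>u \<zeta> k l. if k = l then 0 else \<Sum>b\<in>K - {k} - {l}. u b * haf (K - {b} - {k} - {l}) \<zeta>"
    and "t \<equiv> \<lambda>\<zeta> k. haf (K - {k}) \<zeta>"
    and "e \<equiv> \<lambda>u \<zeta>. exp (- (cmod (\<Sum>b\<in>K. u b * haf (K - {b}) \<zeta>))\<^sup>2 / 4)"
  shows "minor_char (insert d (insert a K)) u = (LINT \<zeta>|cgauss_vec (edges K). of_real (e u \<zeta>) * osc_int K (\<tau> u \<zeta>) (t \<zeta>) (u d) (u a))"
proof -
  define Y where "Y = insert a K"
  have Y: "finite Y" "d \<notin> Y" using K by (auto simp: Y_def)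
  have [measurable]: "haf Y \<in> borel_measurable (cgauss_vec (edges Y))"
    "haf (Y - {b} - {k}) \<in> borel_measurable (cgauss_vec (edges Y))" for b k
    using Y by (auto intro!: measurable_haf)
  define C where "C = (\<lambda>k \<eta>. \<Sum>b\<in>Y - {k}. u b * haf (Y - {b} - {k}) \<eta>)"
  have [measurable]: "C k \<in> borel_measurable (cgauss_vec (edges Y))" for k
    unfolding C_def by measurable
  have hY: "haf Y (add_row a K (y, \<zeta>)) = (\<Sum>k\<in>K. y k * t \<zeta> k)" for y \<zeta>
    unfolding Y_def t_def using haf_add_row_insert[OF K(1,2), of K "(y, \<zeta>)"] by simp
  have Ca: "C a (add_row a K (y, \<zeta>)) = (\<Sum>b\<in>K. u b * haf (K - {b}) \<zeta>)" for y \<zeta>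
  proof -
    have "Y - {a} = K" using K by (auto simp: Y_def)
    moreover have "haf (Y - {b} - {a}) (add_row a K (y, \<zeta>)) = haf (K - {b}) \<zeta>" for b
    proof -
      have "Y - {b} - {a} = K - {b}" using K by (auto simp: Y_def)
      then show ?thesis using haf_add_row[OF K(1,2), of "K - {b}" "(y, \<zeta>)"] by auto
    qed
    ultimately show ?thesis by (simp add: C_def)
  qed
  \<comment> \<open>For \<open>b = a\<close> the vertex \<open>a\<close> is removed, which gives the
    shift; for every other \<open>b\<close> an expansion along \<open>a\<close> gives the linear
    part.\<close>
  have Ck: "C k (add_row a K (y, \<zeta>)) = (\<Sum>l\<in>K. \<tau> u \<zeta> k l * y l) + u a * t \<zeta> k" if k: "k \<in> K" for y \<zeta> k
  proof -
    have Yk: "Y - {k} = insert a (K - {k})" using K k by (auto simp: Y_def)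
    have "C k (add_row a K (y, \<zeta>)) = u a * haf (Y - {a} - {k}) (add_row a K (y, \<zeta>))
        + (\<Sum>b\<in>K - {k}. u b * haf (Y - {b} - {k}) (add_row a K (y, \<zeta>)))"
      unfolding C_def Yk using K by simp
    also have "haf (Y - {a} - {k}) (add_row a K (y, \<zeta>)) = t \<zeta> k"
    proof -
      have "Y - {a} - {k} = K - {k}" using K by (auto simp: Y_def)
      then show ?thesis using haf_add_row[OF K(1,2), of "K - {k}" "(y, \<zeta>)"] by (auto simp: t_def)
    qed
    also have "(\<Sum>b\<in>K - {k}. u b * haf (Y - {b} - {k}) (add_row a K (y, \<zeta>)))
       = (\<Sum>b\<in>K - {k}. \<Sum>l | l \<in> K - {k} \<and> b \<noteq> l. u b * haf (K - {b} - {k} - {l}) \<zeta> * y l)"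
    proof (rule sum.cong[OF refl])
      fix b assume b: "b \<in> K - {k}"
      have "Y - {b} - {k} = insert a (K - {b} - {k})" using K b k by (auto simp: Y_def)
      then have "u b * haf (Y - {b} - {k}) (add_row a K (y, \<zeta>)) = (\<Sum>l\<in>K - {b} - {k}. u b * haf (K - {b} - {k} - {l}) \<zeta> * y l)"
        using haf_add_row_insert[OF K(1,2) subset_trans[OF Diff_subset Diff_subset], of "{b}" "{k}" "(y, \<zeta>)"]
        by (simp add: sum_distrib_left mult_ac)
      also have "\<dots> = (\<Sum>l | l \<in> K - {k} \<and> b \<noteq> l. u b * haf (K - {b} - {k} - {l}) \<zeta> * y l)"
        by (intro sum.cong) auto
      finally show "u b * haf (Y - {b} - {k}) (add_row a K (y, \<zeta>)) = (\<Sum>l | l \<in> K - {k} \<and> b \<noteq> l. u b * haf (K - {b} - {k} - {l}) \<zeta> * y l)"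
        .
    qed
    also have "\<dots> = (\<Sum>l\<in>K - {k}. \<Sum>b | b \<in> K - {k} \<and> b \<noteq> l. u b * haf (K - {b} - {k} - {l}) \<zeta> * y l)"
      by (rule sum.swap_restrict) (use K in auto)
    also have "\<dots> = (\<Sum>l\<in>K - {k}. \<tau> u \<zeta> k l * y l)"
    proof (rule sum.cong[OF refl])
      fix l assume l: "l \<in> K - {k}"
      have "{b. b \<in> K - {k} \<and> b \<noteq> l} = K - {k} - {l}" by auto
      then show "(\<Sum>b | b \<in> K - {k} \<and> b \<noteq> l. u b * haf (K - {b} - {k} - {l}) \<zeta> * y l) = \<tau> u \<zeta> k l * y l"
        using l by (simp add: \<tau>_def sum_distrib_right)
    qed
    also have "\<dots> = (\<Sum>l\<in>K. \<tau> u \<zeta> k l * y l)"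
      using K k by (simp add: sum.remove[of K k] \<tau>_def)
    finally show ?thesis by simp
  qed
  have sumC: "(\<Sum>k\<in>Y. (cmod (C k (add_row a K (y, \<zeta>))))\<^sup>2)
      = (cmod (\<Sum>b\<in>K. u b * haf (K - {b}) \<zeta>))\<^sup>2 + qform K (\<tau> u \<zeta>) (\<lambda>k. u a * t \<zeta> k) y" for y \<zeta>
    using K by (simp add: Y_def Ca qform_def Ck)
  define F where "F = (\<lambda>\<eta>. cis (Re (u d * haf Y \<eta>)) * complex_of_real (exp (- (\<Sum>k\<in>Y. (cmod (C k \<eta>))\<^sup>2) / 4)))"
  have [measurable]: "F \<in> borel_measurable (cgauss_vec (edges Y))"
    unfolding F_def by measurable
  have "minor_char (insert d Y) u = (LINT \<eta>|cgauss_vec (edges Y). F \<eta>)"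
    unfolding F_def C_def by (rule minor_char_insert[OF Y])
  also have "\<dots> = (LINT \<zeta>|cgauss_vec (edges K). LINT y|cgauss_vec K. F (add_row a K (y, \<zeta>)))"
    unfolding Y_def by (rule integral_add_row(1)[OF K(1,2)])
      (auto simp: Y_def[symmetric] F_def norm_mult sum_nonneg)
  also have "\<dots> = (LINT \<zeta>|cgauss_vec (edges K). of_real (e u \<zeta>) * osc_int K (\<tau> u \<zeta>) (t \<zeta>) (u d) (u a))"
  proof (rule arg_cong[where f="integral\<^sup>L _"], rule ext)
    fix \<zeta>
    have ud: "u d * (\<Sum>k\<in>K. y k * t \<zeta> k) = (\<Sum>k\<in>K. u d * t \<zeta> k * y k)" for y
      by (simp add: sum_distrib_left mult_ac)
    have "F (add_row a K (y, \<zeta>)) = of_real (e u \<zeta>) * (of_real (exp (- qform K (\<tau> u \<zeta>) (\<lambda>k. u a * t \<zeta> k) y / 4))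
        * cis (Re (\<Sum>k\<in>K. u d * t \<zeta> k * y k)))" for y
      unfolding F_def sumC hY ud e_def by (simp only: exp_neg_quarter_add of_real_mult mult_ac)
    then show "(LINT y|cgauss_vec K. F (add_row a K (y, \<zeta>))) = of_real (e u \<zeta>) * osc_int K (\<tau> u \<zeta>) (t \<zeta>) (u d) (u a)"
      by (simp add: osc_int_def)
  qed
  finally show ?thesis by (simp add: Y_def)
qed

text \<open>Condition on the matrix on \<open>K\<close>: \<open>\<tau>\<close>, \<open>t\<close> and
  \<open>e\<close> do not see the entries of \<open>u\<close> at \<open>a\<close> and
  \<open>d\<close>. After the triangle inequality, \<open>osc_int_norm\<close> identifies the
  modulus of the integrand with the integrand of the modified row.\<close>

lemma minor_char_pair_step:
  assumes X: "finite X" "a \<in> X" "d \<in> X" "a \<noteq> d"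
  shows "cmod (minor_char X u) \<le> cmod (minor_char X (u(a := 0, d := of_real (sqrt ((cmod (u d))\<^sup>2 + (cmod (u a))\<^sup>2)))))"
proof -
  define K where "K = X - {a, d}"
  define u' where "u' = u(a := 0, d := complex_of_real (sqrt ((cmod (u d))\<^sup>2 + (cmod (u a))\<^sup>2)))"
  have K: "finite K" "a \<notin> K" "d \<notin> K" "a \<noteq> d" and XK: "X = insert d (insert a K)"
    using X by (auto simp: K_def)
  define \<tau> where "\<tau> = (\<lambda>(u :: nat \<Rightarrow> complex) \<zeta> k l. if k = l then 0 else \<Sum>b\<in>K - {k} - {l}. u b * haf (K - {b} - {k} - {l}) \<zeta>)"
  define t where "t = (\<lambda>\<zeta> k. haf (K - {k}) \<zeta>)"
  define e where "e = (\<lambda>(u :: nat \<Rightarrow> complex) \<zeta>. exp (- (cmod (\<Sum>b\<in>K. u b * haf (K - {b}) \<zeta>))\<^sup>2 / 4))"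
  have row: "minor_char X v = (LINT \<zeta>|cgauss_vec (edges K). of_real (e v \<zeta>) * osc_int K (\<tau> v \<zeta>) (t \<zeta>) (v d) (v a))" for v
    unfolding XK \<tau>_def t_def e_def by (rule minor_char_insert2[OF K])
  have u': "u' b = u b" if "b \<in> K" for b using that K by (auto simp: u'_def)
  have e': "e u' = e u" unfolding e_def by (intro ext) (simp add: u')
  have \<tau>': "\<tau> u' = \<tau> u" unfolding \<tau>_def by (intro ext) (auto intro!: sum.cong simp: u')
  have sym: "\<tau> u \<zeta> k l = \<tau> u \<zeta> l k" for \<zeta> k l
  proof -
    have "K - {k} - {l} = K - {l} - {k}" "K - {b} - {k} - {l} = K - {b} - {l} - {k}" for b by auto
    then show ?thesis by (simp only: \<tau>_def eq_commute[of k l])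
  qed
  have u'ad: "u' a = 0" "u' d = of_real (sqrt ((cmod (u d))\<^sup>2 + (cmod (u a))\<^sup>2))"
    using K by (auto simp: u'_def)
  define I where "I = (\<lambda>\<zeta>. e u \<zeta> * cmod (osc_int K (\<tau> u \<zeta>) (t \<zeta>) (u d) (u a)))"
  have "minor_char X u' = (LINT \<zeta>|cgauss_vec (edges K). of_real (I \<zeta>))"
    unfolding row e' \<tau>' u'ad osc_int_norm[OF K(1) sym, symmetric] I_def by simp
  then have 1: "cmod (minor_char X u') = \<bar>LINT \<zeta>|cgauss_vec (edges K). I \<zeta>\<bar>"
    by simp
  have "cmod (minor_char X u) \<le> (LINT \<zeta>|cgauss_vec (edges K). cmod (of_real (e u \<zeta>) * osc_int K (\<tau> u \<zeta>) (t \<zeta>) (u d) (u a)))"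
    unfolding row by (rule integral_norm_bound)
  also have "\<dots> = (LINT \<zeta>|cgauss_vec (edges K). I \<zeta>)"
    by (simp add: I_def norm_mult e_def)
  finally show ?thesis unfolding 1 u'_def[symmetric] by linarith
qed

text \<open>Induction on \<open>D\<close>, moving one entry at a time into position
  \<open>d\<close>, where the squared moduli accumulate.\<close>

lemma minor_char_funnel:
  assumes X: "finite X" "d \<in> X" and D: "finite D" "D \<noteq> {}" "D \<subseteq> X - {d}"
  shows "cmod (minor_char X u) \<le> cmod (minor_char X (\<lambda>b. if b = d then of_real (sqrt ((cmod (u d))\<^sup>2 + (\<Sum>b\<in>D. (cmod (u b))\<^sup>2)))
     else if b \<in> D then 0 else u b))"
  using D
proof (induction D arbitrary: u rule: finite_ne_induct)
  case (singleton a)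
  have "u(a := 0, d := of_real (sqrt ((cmod (u d))\<^sup>2 + (cmod (u a))\<^sup>2)))
     = (\<lambda>b. if b = d then of_real (sqrt ((cmod (u d))\<^sup>2 + (\<Sum>b\<in>{a}. (cmod (u b))\<^sup>2))) else if b \<in> {a} then 0 else u b)"
    by (auto simp: fun_eq_iff)
  then show ?case using minor_char_pair_step[of X a d u] X singleton by auto
next
  case (insert a D)
  define u' where "u' = u(a := 0, d := complex_of_real (sqrt ((cmod (u d))\<^sup>2 + (cmod (u a))\<^sup>2)))"
  have "cmod (minor_char X u) \<le> cmod (minor_char X u')"
    unfolding u'_def using X insert.prems by (intro minor_char_pair_step) auto
  also have "\<dots> \<le> cmod (minor_char X (\<lambda>b. if b = d then of_real (sqrt ((cmod (u' d))\<^sup>2 + (\<Sum>b\<in>D. (cmod (u' b))\<^sup>2)))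
     else if b \<in> D then 0 else u' b))"
    using insert.prems by (intro insert.IH) auto
  also have "(\<lambda>b. if b = d then complex_of_real (sqrt ((cmod (u' d))\<^sup>2 + (\<Sum>b\<in>D. (cmod (u' b))\<^sup>2))) else if b \<in> D then 0 else u' b)
     = (\<lambda>b. if b = d then of_real (sqrt ((cmod (u d))\<^sup>2 + (\<Sum>b\<in>insert a D. (cmod (u b))\<^sup>2))) else if b \<in> insert a D then 0 else u b)"
  proof -
    have "(\<Sum>b\<in>D. (cmod (u' b))\<^sup>2) = (\<Sum>b\<in>D. (cmod (u b))\<^sup>2)"
      using insert by (intro sum.cong) (auto simp: u'_def)
    then show ?thesis
      using insert by (auto simp: fun_eq_iff u'_def add.assoc)
  qed
  finally show ?case .
qed

lemma minor_char_le_haf_char: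
  assumes X: "finite X" "d \<in> X" "X - {d} \<noteq> {}"
  shows "cmod (minor_char X u) \<le> cmod (haf_char (X - {d}) (of_real (sqrt (\<Sum>b\<in>X. (cmod (u b))\<^sup>2))))"
proof -
  define u' where "u' = (\<lambda>b. if b = d then complex_of_real (sqrt ((cmod (u d))\<^sup>2 + (\<Sum>b\<in>X - {d}. (cmod (u b))\<^sup>2)))
     else if b \<in> X - {d} then 0 else u b)"
  have "cmod (minor_char X u) \<le> cmod (minor_char X u')"
    unfolding u'_def using X by (intro minor_char_funnel) auto
  also have "minor_char X u' = haf_char (X - {d}) (u' d)"
    using X by (intro minor_char_single) (auto simp: u'_def)
  also have "u' d = of_real (sqrt (\<Sum>b\<in>X. (cmod (u b))\<^sup>2))"
    using X by (simp add: u'_def sum.remove[of X d])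
  finally show ?thesis .
qed

section \<open>The inverse moment bound\<close>

definition laplace_minors :: "nat set \<Rightarrow> real \<Rightarrow> ennreal" where
  "laplace_minors X s = (\<integral>\<^sup>+\<eta>. ennreal (exp (- (s * minor_norm2 X \<eta>))) \<partial>cgauss_vec (edges X))"

text \<open>In \<open>ennreal\<close> the inverse of zero is infinite, so finiteness also encodes
  that \<open>minor_norm2\<close> is positive almost surely.\<close>

definition inverse_moment :: "nat set \<Rightarrow> ennreal" where
  "inverse_moment X = (\<integral>\<^sup>+\<eta>. inverse (ennreal (minor_norm2 X \<eta>)) \<partial>cgauss_vec (edges X))"

text \<open>For \<open>a = 0\<close> both sides are infinite; including this case spares later uses
  a positivity assumption.\<close>

lemma nn_integral_exp_decay:
  assumes a: "a \<ge> 0"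
  shows "(\<integral>\<^sup>+s. ennreal (exp (- (s * a))) * indicator {0..} s \<partial>lborel) = inverse (ennreal a)"
proof (cases "a = 0")
  case True
  have "of_nat n \<le> emeasure lborel {0::real..}" for n
    using emeasure_mono[of "{0..real n}" "{0::real..}" lborel] by (simp add: ennreal_of_nat_eq_real_of_nat)
  then have "(SUP n. of_nat n) \<le> emeasure lborel {0::real..}"
    by (rule SUP_least)
  then have "emeasure lborel {0::real..} = \<top>"
    by (simp add: ennreal_SUP_of_nat_eq_top top_unique)
  with True show ?thesis by simp
next
  case False
  with a have a: "a > 0" by simp
  have "(\<integral>\<^sup>+s. ennreal (exp (- (s * a))) * indicator {0..} s \<partial>lborel) = ennreal (0 - (- exp (- (0 * a)) / a))"
  proof (rule nn_integral_FTC_atLeast)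
    show "((\<lambda>s. - exp (- (s * a)) / a) \<longlongrightarrow> 0) at_top"
      using a by real_asymp
    show "((\<lambda>s. - exp (- (s * a)) / a) has_real_derivative exp (- (s * a))) (at s)" for s
      using a by (auto intro!: derivative_eq_intros)
  qed auto
  then show ?thesis using a by (simp add: inverse_ennreal inverse_eq_divide)
qed

text \<open>If a factor is zero, its inverse is infinite and the other inverse is nonzero, so zero
  never meets infinity.\<close>

lemma inverse_ennreal_mult:
  assumes "a \<ge> 0" "b \<ge> 0"
  shows "inverse (ennreal (a * b)) = inverse (ennreal a) * inverse (ennreal b)"
proof -
  consider "a = 0" "b = 0" | "a = 0" "b > 0" | "a > 0" "b = 0" | "a > 0" "b > 0"
    using assms by (auto simp: less_le)
  then show ?thesis
    by cases (auto simp: inverse_ennreal ennreal_mult[symmetric] ennreal_top_mult ennreal_mult_top)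
qed

text \<open>Averaging over a row leaves a positive integrand, so the modulus of the characteristic
  function is itself a Laplace transform.\<close>

lemma cmod_haf_char_insert:
  assumes X: "finite X" "c \<notin> X"
  shows "ennreal (cmod (haf_char (insert c X) r)) = laplace_minors X ((cmod r)\<^sup>2 / 4)"
proof -
  interpret prob_space "cgauss_vec (edges X)" by (rule prob_space_cgauss_vec)
  note [measurable] = measurable_minor_norm2[OF X(1)]
  define e where "e = (\<lambda>\<eta>. exp (- ((cmod r)\<^sup>2 / 4 * minor_norm2 X \<eta>)))"
  have [measurable]: "e \<in> borel_measurable (cgauss_vec (edges X))" unfolding e_def by measurable
  have int: "integrable (cgauss_vec (edges X)) e"
    by (rule integrable_const_bound[of _ 1]) (auto simp: e_def minor_norm2_nonneg)
  have "haf_char (insert c X) r = (LINT \<eta>|cgauss_vec (edges X). of_real (e \<eta>))"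
    unfolding haf_char_insert(1)[OF X] by (simp add: e_def)
  then have "cmod (haf_char (insert c X) r) = \<bar>LINT \<eta>|cgauss_vec (edges X). e \<eta>\<bar>" by simp
  also have "\<dots> = (LINT \<eta>|cgauss_vec (edges X). e \<eta>)"
    by (intro abs_of_nonneg integral_nonneg_AE) (simp add: e_def)
  finally show ?thesis
    using nn_integral_eq_integral[OF int] by (simp add: laplace_minors_def e_def)
qed

text \<open>The Laplace transform is a characteristic function of a hafnian with one more vertex,
  hence an average of \<open>minor_char\<close> over Gaussian rows. Concentrating each row bounds it
  by the characteristic function of a smaller hafnian, again a Laplace transform.\<close>

lemma laplace_minors_le:
  assumes X: "finite X" "d \<in> X" "e \<in> X" "d \<noteq> e" and s: "s \<ge> 0"
  shows "laplace_minors X s \<le> (\<integral>\<^sup>+x. laplace_minors (X - {d} - {e}) (s * (\<Sum>b\<in>X. (cmod (x b))\<^sup>2)) \<partial>cgauss_vec X)"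
proof -
  interpret G: prob_space "cgauss_vec X" by (rule prob_space_cgauss_vec)
  interpret E: prob_space "cgauss_vec (edges X)" by (rule prob_space_cgauss_vec)
  \<comment> \<open>Chosen so that \<open>(cmod r)\<^sup>2 / 4 = s\<close>.\<close>
  define r where "r = complex_of_real (2 * sqrt s)"
  obtain c where c: "c \<notin> X" using X(1) ex_new_if_finite infinite_UNIV_nat by blast
  have [measurable]: "haf (X - {b}) \<in> borel_measurable (cgauss_vec (edges X))" for b
    using X by (intro measurable_haf) auto
  have [measurable]: "(\<lambda>x. minor_char X (\<lambda>b. r * x b)) \<in> borel_measurable (cgauss_vec X)"
    unfolding minor_char_def by measurable
  have mb: "cmod (minor_char X u) \<le> 1" for u
    unfolding minor_char_def by (rule order.trans[OF integral_norm_bound]) (simp add: E.prob_space)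
  have "laplace_minors X s = ennreal (cmod (haf_char (insert c X) r))"
    using s by (simp add: cmod_haf_char_insert[OF X(1) c] r_def power_mult_distrib norm_mult)
  also have "\<dots> \<le> (\<integral>\<^sup>+x. cmod (minor_char X (\<lambda>b. r * x b)) \<partial>cgauss_vec X)"
    unfolding haf_char_insert(2)[OF X(1) c] by (intro integral_norm_bound_ennreal integrable_cgauss_vec_bounded) (auto simp: mb)
  also have "\<dots> \<le> (\<integral>\<^sup>+x. laplace_minors (X - {d} - {e}) (s * (\<Sum>b\<in>X. (cmod (x b))\<^sup>2)) \<partial>cgauss_vec X)"
  proof (intro nn_integral_mono)
    fix x
    have "cmod (minor_char X (\<lambda>b. r * x b)) \<le> cmod (haf_char (X - {d}) (of_real (sqrt (\<Sum>b\<in>X. (cmod (r * x b))\<^sup>2))))"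
      using X by (intro minor_char_le_haf_char) auto
    \<comment> \<open>Splitting off a second vertex \<open>e\<close> gives the hafnian of
      \<open>X - {d}\<close> a row to average over.\<close>
    then have "ennreal (cmod (minor_char X (\<lambda>b. r * x b))) \<le> ennreal (cmod (haf_char (insert e (X - {d} - {e})) (of_real (sqrt (\<Sum>b\<in>X. (cmod (r * x b))\<^sup>2)))))"
      using X by (simp add: insert_absorb ennreal_leI)
    also have "\<dots> = laplace_minors (X - {d} - {e}) ((\<Sum>b\<in>X. (cmod (r * x b))\<^sup>2) / 4)"
      using X by (subst cmod_haf_char_insert) (auto simp: sum_nonneg)
    also have "(\<Sum>b\<in>X. (cmod (r * x b))\<^sup>2) / 4 = s * (\<Sum>b\<in>X. (cmod (x b))\<^sup>2)"
      using s by (simp add: r_def norm_mult power_mult_distrib sum_distrib_left[symmetric])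
    finally show "ennreal (cmod (minor_char X (\<lambda>b. r * x b))) \<le> laplace_minors (X - {d} - {e}) (s * (\<Sum>b\<in>X. (cmod (x b))\<^sup>2))" .
  qed
  finally show ?thesis .
qed

lemma nn_integral_inverse_power:
  "(\<integral>\<^sup>+s. ennreal ((1 / (1 + s)) ^ Suc (Suc n)) * indicator {0..} s \<partial>lborel) = ennreal (1 / real (Suc n))"
proof -
  have "(\<integral>\<^sup>+s. ennreal ((1 / (1 + s)) ^ Suc (Suc n)) * indicator {0..} s \<partial>lborel)
      = ennreal (0 - (- ((1 / (1 + 0)) ^ Suc n) / real (Suc n)))"
  proof (rule nn_integral_FTC_atLeast)
    show "((\<lambda>s. - ((1 / (1 + s)) ^ Suc n) / real (Suc n)) \<longlongrightarrow> 0) at_top"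
    proof -
      have "((\<lambda>s::real. 1 / (1 + s)) \<longlongrightarrow> 0) at_top" by real_asymp
      then have "((\<lambda>s::real. - ((1 / (1 + s)) ^ Suc n) / real (Suc n)) \<longlongrightarrow> - (0 ^ Suc n) / real (Suc n)) at_top"
        by (intro tendsto_intros) auto
      then show ?thesis by simp
    qed
    fix s :: real assume s: "0 \<le> s"
    have "((\<lambda>s. 1 / (1 + s)) has_real_derivative - (1 / (1 + s))\<^sup>2) (at s)"
      using s by (auto intro!: derivative_eq_intros simp: power2_eq_square)
    note D = DERIV_power[OF this, of "Suc n"]
    have "((\<lambda>s. (1 / (1 + s)) ^ Suc n * (- 1 / real (Suc n))) has_real_derivative
       (real (Suc n) * (- (1 / (1 + s))\<^sup>2 * (1 / (1 + s)) ^ (Suc n - Suc 0))) * (- 1 / real (Suc n))) (at s)"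
      by (rule DERIV_cmult_right[OF D])
    moreover have "(\<lambda>s. (1 / (1 + s)) ^ Suc n * (- 1 / real (Suc n))) = (\<lambda>s. - ((1 / (1 + s)) ^ Suc n) / real (Suc n))"
      by auto
    moreover have "(real (Suc n) * (- (1 / (1 + s))\<^sup>2 * (1 / (1 + s)) ^ (Suc n - Suc 0))) * (- 1 / real (Suc n)) = (1 / (1 + s)) ^ Suc (Suc n)"
    proof -
      have "(real (Suc n) * (- q\<^sup>2 * q ^ n)) * (- 1 / real (Suc n)) = q ^ Suc (Suc n)" for q :: real
        by (simp add: power2_eq_square)
      from this[of "1 / (1 + s)"] show ?thesis unfolding diff_Suc_Suc diff_zero .
    qed
    ultimately show "((\<lambda>s. - ((1 / (1 + s)) ^ Suc n) / real (Suc n)) has_real_derivative (1 / (1 + s)) ^ Suc (Suc n)) (at s)"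
      by metis
  qed (auto simp del: power_Suc)
  then show ?thesis by simp
qed

text \<open>The inverse is an integral of exponentials over \<open>s \<ge> 0\<close>. These factor
  over the coordinates, each contributing \<open>1 / (1 + s)\<close>; having at least two
  coordinates makes the integral converge.\<close>

lemma nn_integral_inverse_norm_cgauss_vec:
  assumes X: "finite X" "card X = Suc (Suc n)"
  shows "(\<integral>\<^sup>+x. inverse (ennreal (\<Sum>b\<in>X. (cmod (x b))\<^sup>2)) \<partial>cgauss_vec X) = ennreal (1 / real (Suc n))"
proof -
  interpret G: prob_space "cgauss_vec X" by (rule prob_space_cgauss_vec)
  interpret P: pair_sigma_finite lborel "cgauss_vec X" ..
  have "(\<integral>\<^sup>+x. inverse (ennreal (\<Sum>b\<in>X. (cmod (x b))\<^sup>2)) \<partial>cgauss_vec X)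
      = (\<integral>\<^sup>+x. \<integral>\<^sup>+s. ennreal (exp (- (s * (\<Sum>b\<in>X. (cmod (x b))\<^sup>2)))) * indicator {0..} s \<partial>lborel \<partial>cgauss_vec X)"
    by (subst nn_integral_exp_decay) (auto simp: sum_nonneg)
  also have "\<dots> = (\<integral>\<^sup>+s. \<integral>\<^sup>+x. ennreal (exp (- (s * (\<Sum>b\<in>X. (cmod (x b))\<^sup>2)))) * indicator {0..} s \<partial>cgauss_vec X \<partial>lborel)"
    by (rule P.Fubini') measurable
  also have "\<dots> = (\<integral>\<^sup>+s. ennreal ((1 / (1 + s)) ^ Suc (Suc n)) * indicator {0..} s \<partial>lborel)"
  proof (rule nn_integral_cong)
    fix s :: real
    show "(\<integral>\<^sup>+x. ennreal (exp (- (s * (\<Sum>b\<in>X. (cmod (x b))\<^sup>2)))) * indicator {0..} s \<partial>cgauss_vec X)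
      = ennreal ((1 / (1 + s)) ^ Suc (Suc n)) * indicator {0..} s"
    proof (cases "s \<ge> 0")
      case True
      have "(\<integral>\<^sup>+x. ennreal (exp (- (s * (\<Sum>b\<in>X. (cmod (x b))\<^sup>2)))) \<partial>cgauss_vec X)
         = (\<integral>\<^sup>+x. (\<Prod>b\<in>X. ennreal (exp (- (s * (cmod (x b))\<^sup>2)))) \<partial>cgauss_vec X)"
        by (intro nn_integral_cong) (simp add: prod_ennreal exp_sum[symmetric] X sum_distrib_left sum_negf)
      also have "\<dots> = (\<Prod>b\<in>X. \<integral>\<^sup>+z. ennreal (exp (- (s * (cmod z)\<^sup>2))) \<partial>cgauss)"
        by (rule cgauss_prod.product_nn_integral_prod) (auto simp: X)
      also have "\<dots> = ennreal ((1 / (1 + s)) ^ Suc (Suc n))"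
        using True X by (simp add: nn_integral_laplace_cgauss ennreal_power del: power_Suc)
      finally show ?thesis using True by simp
    qed simp
  qed
  also have "\<dots> = ennreal (1 / real (Suc n))" by (rule nn_integral_inverse_power)
  finally show ?thesis .
qed

lemma inverse_moment_eq_laplace_minors:
  assumes X: "finite X"
  shows "inverse_moment X = (\<integral>\<^sup>+s. laplace_minors X s * indicator {0..} s \<partial>lborel)"
proof -
  interpret E: prob_space "cgauss_vec (edges X)" by (rule prob_space_cgauss_vec)
  interpret P: pair_sigma_finite lborel "cgauss_vec (edges X)" ..
  note [measurable] = measurable_minor_norm2[OF X]
  have "inverse_moment X = (\<integral>\<^sup>+\<eta>. \<integral>\<^sup>+s. ennreal (exp (- (s * minor_norm2 X \<eta>))) * indicator {0..} s \<partial>lborel \<partial>cgauss_vec (edges X))"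
    unfolding inverse_moment_def by (subst nn_integral_exp_decay) (auto simp: minor_norm2_nonneg)
  also have "\<dots> = (\<integral>\<^sup>+s. \<integral>\<^sup>+\<eta>. ennreal (exp (- (s * minor_norm2 X \<eta>))) * indicator {0..} s \<partial>cgauss_vec (edges X) \<partial>lborel)"
    by (rule P.Fubini') measurable
  also have "\<dots> = (\<integral>\<^sup>+s. laplace_minors X s * indicator {0..} s \<partial>lborel)"
    unfolding laplace_minors_def by (intro nn_integral_cong nn_integral_multc) measurable
  finally show ?thesis .
qed

text \<open>Integrate \<open>laplace_minors_le\<close> over \<open>s\<close>. The inner integral is
  the inverse of \<open>q x * minor_norm2 Z \<zeta>\<close>, and independence of the row and the
  smaller matrix splits its expectation into two factors.\<close>

lemma inverse_moment_le_step:
  assumes X: "finite X" "d \<in> X" "e \<in> X" "d \<noteq> e" "card X = Suc (Suc n)"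
  shows "inverse_moment X \<le> ennreal (1 / real (Suc n)) * inverse_moment (X - {d} - {e})"
proof -
  define Z where "Z = X - {d} - {e}"
  have Z: "finite Z" using X by (simp add: Z_def)
  interpret G: prob_space "cgauss_vec X" by (rule prob_space_cgauss_vec)
  interpret P: pair_sigma_finite lborel "cgauss_vec X" ..
  interpret E: prob_space "cgauss_vec (edges Z)" by (rule prob_space_cgauss_vec)
  interpret Q: pair_sigma_finite lborel "cgauss_vec (edges Z)" ..
  note [measurable] = measurable_minor_norm2[OF Z]
  define q where "q = (\<lambda>x::nat \<Rightarrow> complex. \<Sum>b\<in>X. (cmod (x b))\<^sup>2)"
  have q0: "q x \<ge> 0" for x by (simp add: q_def sum_nonneg)
  have [measurable]: "q \<in> borel_measurable (cgauss_vec X)" unfolding q_def by measurable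
  have [measurable]: "laplace_minors Z \<in> borel_measurable borel"
    unfolding laplace_minors_def by measurable
  have "inverse_moment X = (\<integral>\<^sup>+s. laplace_minors X s * indicator {0..} s \<partial>lborel)" by (rule inverse_moment_eq_laplace_minors[OF X(1)])
  also have "\<dots> \<le> (\<integral>\<^sup>+s. (\<integral>\<^sup>+x. laplace_minors Z (s * q x) \<partial>cgauss_vec X) * indicator {0..} s \<partial>lborel)"
    using laplace_minors_le[OF X(1-4)] by (intro nn_integral_mono) (auto simp: Z_def q_def split: split_indicator)
  also have "\<dots> = (\<integral>\<^sup>+s. \<integral>\<^sup>+x. laplace_minors Z (s * q x) * indicator {0..} s \<partial>cgauss_vec X \<partial>lborel)"
    by (intro nn_integral_cong nn_integral_multc[symmetric]) measurable
  also have "\<dots> = (\<integral>\<^sup>+x. \<integral>\<^sup>+s. laplace_minors Z (s * q x) * indicator {0..} s \<partial>lborel \<partial>cgauss_vec X)"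
    by (rule P.Fubini'[symmetric]) measurable
  also have "\<dots> = (\<integral>\<^sup>+x. inverse (ennreal (q x)) * inverse_moment Z \<partial>cgauss_vec X)"
  proof (rule nn_integral_cong)
    fix x
    have "(\<integral>\<^sup>+s. laplace_minors Z (s * q x) * indicator {0..} s \<partial>lborel)
        = (\<integral>\<^sup>+s. \<integral>\<^sup>+\<zeta>. ennreal (exp (- (s * (q x * minor_norm2 Z \<zeta>)))) * indicator {0..} s \<partial>cgauss_vec (edges Z) \<partial>lborel)"
      unfolding laplace_minors_def by (intro nn_integral_cong) (simp add: nn_integral_multc mult.assoc)
    also have "\<dots> = (\<integral>\<^sup>+\<zeta>. \<integral>\<^sup>+s. ennreal (exp (- (s * (q x * minor_norm2 Z \<zeta>)))) * indicator {0..} s \<partial>lborel \<partial>cgauss_vec (edges Z))"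
      by (rule Q.Fubini'[symmetric]) measurable
    also have "\<dots> = (\<integral>\<^sup>+\<zeta>. inverse (ennreal (q x)) * inverse (ennreal (minor_norm2 Z \<zeta>)) \<partial>cgauss_vec (edges Z))"
      by (simp add: nn_integral_exp_decay inverse_ennreal_mult q0 minor_norm2_nonneg)
    also have "\<dots> = inverse (ennreal (q x)) * inverse_moment Z"
      unfolding inverse_moment_def by (rule nn_integral_cmult) measurable
    finally show "(\<integral>\<^sup>+s. laplace_minors Z (s * q x) * indicator {0..} s \<partial>lborel) = inverse (ennreal (q x)) * inverse_moment Z" .
  qed
  also have "\<dots> = (\<integral>\<^sup>+x. inverse (ennreal (q x)) \<partial>cgauss_vec X) * inverse_moment Z"
    by (rule nn_integral_multc) measurable
  also have "(\<integral>\<^sup>+x. inverse (ennreal (q x)) \<partial>cgauss_vec X) = ennreal (1 / real (Suc n))"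
    unfolding q_def by (rule nn_integral_inverse_norm_cgauss_vec[OF X(1,5)])
  finally show ?thesis by (simp add: Z_def)
qed

text \<open>Two vertices are removed per step. For a single vertex the only minor is the empty
  hafnian, which is 1.\<close>

lemma inverse_moment_le:
  assumes "finite X" "card X = Suc (2 * m)"
  shows "inverse_moment X \<le> ennreal (1 / (2 ^ m * fact m))"
  using assms
proof (induction m arbitrary: X)
  case 0
  obtain b where "X = {b}" using 0 by (auto simp: card_1_singleton_iff)
  then show ?case by (simp add: inverse_moment_def minor_norm2_def prob_space.emeasure_space_1[OF prob_space_cgauss_vec])
next
  case (Suc m)
  then have c: "card X = Suc (Suc (Suc (2 * m)))" by simp
  then obtain d where d: "d \<in> X" using Suc.prems(1) by (metis card_eq_0_iff ex_in_conv nat.distinct(1))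
  have c': "card (X - {d}) = Suc (Suc (2 * m))" using c d Suc.prems(1) by simp
  then obtain e where e: "e \<in> X - {d}" using Suc.prems(1) by (metis card_eq_0_iff ex_in_conv finite_Diff nat.distinct(1))
  have c'': "card (X - {d} - {e}) = Suc (2 * m)" using c' e Suc.prems(1) by simp
  \<comment> \<open>With \<open>2 * m + 3\<close> vertices the factor is
    \<open>1 / (2 * m + 2)\<close>, which supplies a 2 to the power and \<open>m + 1\<close> to the
    factorial.\<close>
  have "inverse_moment X \<le> ennreal (1 / real (Suc (Suc (2 * m)))) * inverse_moment (X - {d} - {e})"
    using c d e Suc.prems(1) by (intro inverse_moment_le_step) auto
  also have "\<dots> \<le> ennreal (1 / real (Suc (Suc (2 * m)))) * ennreal (1 / (2 ^ m * fact m))"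
    using Suc.IH[OF _ c''] Suc.prems(1) by (intro mult_left_mono) auto
  also have "\<dots> = ennreal (1 / real (Suc (Suc (2 * m))) * (1 / (2 ^ m * fact m)))"
    by (rule ennreal_mult[symmetric]) auto
  also have "1 / real (Suc (Suc (2 * m))) * (1 / (2 ^ m * fact m)) = 1 / (2 ^ Suc m * fact (Suc m))"
    by (simp add: field_simps)
  finally show ?case .
qed

section \<open>The constant\<close>

lemma odd_double_fact_pos: "odd_double_fact n > 0"
  by (auto simp: odd_double_fact_def)

lemma odd_double_fact_Suc: "odd_double_fact (Suc n) = odd_double_fact n * (2 * n + 1)"
  by (simp add: odd_double_fact_def)

lemma odd_double_fact_fact: "odd_double_fact n * (2 ^ n * fact n) = fact (2 * n)"
proof (induction n)
  case (Suc n)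
  have "odd_double_fact (Suc n) * (2 ^ Suc n * fact (Suc n))
      = (odd_double_fact n * (2 ^ n * fact n)) * ((2 * n + 1) * (2 * n + 2))"
    by (simp add: odd_double_fact_Suc algebra_simps)
  also have "\<dots> = fact (2 * Suc n)"
    unfolding Suc by (simp add: algebra_simps)
  finally show ?case .
qed (simp add: odd_double_fact_def)

lemma B_eq_binomial:
  assumes "n \<ge> 1"
  shows "B n = 2 * real n / 4 ^ n * real ((2 * n) choose n)"
proof -
  obtain m where n: "n = Suc m" using assms by (cases n) auto
  have "real ((2 * n) choose n) = fact (2 * n) / (fact n * fact n)"
    using binomial_fact[of n "2 * n", where 'a=real] by (simp add: mult_2)
  also have "\<dots> = real (odd_double_fact n) * (2 ^ n * fact n) / (fact n * fact n)"
    using odd_double_fact_fact[of n] by (metis of_nat_fact of_nat_mult of_nat_numeral of_nat_power)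
  finally have C: "real ((2 * n) choose n) = real (odd_double_fact n) * 2 ^ n / fact n"
    by simp
  have "(4::real) ^ n = 2 ^ n * 2 ^ n" by (simp flip: power_mult_distrib)
  then have "2 * real n / 4 ^ n * real ((2 * n) choose n) = 2 * real n * real (odd_double_fact n) / (2 ^ n * fact n)"
    unfolding C by simp
  also have "\<dots> = B n"
    unfolding B_def n by (simp del: of_nat_Suc)
  finally show ?thesis ..
qed

text \<open>Expresses the double factorial through Gamma, where log-convexity is available.\<close>

lemma Gamma_half_odd_double_fact:
  "Gamma (real n + 1 / 2) = real (odd_double_fact n) / 2 ^ n * sqrt pi"
proof (induction n)
  case 0
  show ?case by (simp add: odd_double_fact_def Gamma_one_half_real)
next
  case (Suc n)
  have "Gamma (real (Suc n) + 1 / 2) = Gamma ((real n + 1 / 2) + 1)" by (simp add: algebra_simps)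
  also have "\<dots> = (real n + 1 / 2) * Gamma (real n + 1 / 2)"
    by (rule Gamma_plus1) (auto elim!: nonpos_Ints_cases')
  also have "\<dots> = real (odd_double_fact (Suc n)) / 2 ^ Suc n * sqrt pi"
    unfolding Suc by (simp add: odd_double_fact_Suc field_simps)
  finally show ?case .
qed

text \<open>Log-convexity of Gamma at the midpoint of \<open>n\<close> and \<open>n + 1\<close>
  bounds the square of \<open>Gamma (n + 1/2)\<close> by \<open>n\<close> times that of
  \<open>Gamma n\<close>, and
  \<open>B n = 2 * Gamma (n + 1/2) / (sqrt pi * Gamma n)\<close>.\<close>

lemma B_le_sqrt:
  assumes n: "n \<ge> 1"
  shows "B n \<le> 2 * sqrt (real n / pi)"
proof -
  have pos: "Gamma (real n) > 0" "Gamma (real n + 1) > 0" "Gamma (real n + 1/2) > 0"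
    using n by (auto intro!: Gamma_real_pos)
  have "(ln \<circ> Gamma) ((1 - 1/2) *\<^sub>R real n + (1/2) *\<^sub>R (real n + 1)) \<le> (1 - 1/2) * (ln \<circ> Gamma) (real n) + (1/2) * (ln \<circ> Gamma) (real n + 1)"
    using n by (intro convex_onD[OF log_convex_Gamma_real]) auto
  moreover have "(1 - 1/2) *\<^sub>R real n + (1/2) *\<^sub>R (real n + 1) = real n + 1/2" by (simp add: field_simps)
  ultimately have "2 * ln (Gamma (real n + 1/2)) \<le> ln (Gamma (real n)) + ln (Gamma (real n + 1))" by simp
  moreover have "c\<^sup>2 \<le> a * b" if "2 * ln c \<le> ln a + ln b" "a > 0" "b > 0" "c > 0" for a b c :: real
  proof -
    have "ln (c\<^sup>2) \<le> ln (a * b)" using that by (simp add: ln_mult_pos ln_realpow)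
    then show ?thesis using that by simp
  qed
  ultimately have "(Gamma (real n + 1/2))\<^sup>2 \<le> Gamma (real n) * Gamma (real n + 1)"
    using pos by blast
  also have "Gamma (real n + 1) = real n * Gamma (real n)"
    using n by (intro Gamma_plus1) (auto elim!: nonpos_Ints_cases')
  finally have G: "(Gamma (real n + 1/2))\<^sup>2 \<le> real n * (Gamma (real n))\<^sup>2"
    by (simp add: power2_eq_square mult_ac)
  have Gn: "Gamma (real n) = fact (n - 1)"
    using n Gamma_fact[of "n - 1", where 'a=real] by (simp add: of_nat_diff)
  have "B n = 2 * Gamma (real n + 1/2) / (sqrt pi * Gamma (real n))"
  proof -
    have "(2::real) ^ n = 2 * 2 ^ (n - 1)" using n by (cases n) auto
    then show ?thesis unfolding Gamma_half_odd_double_fact Gn B_def by simp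
  qed
  then have "(B n)\<^sup>2 = 4 * (Gamma (real n + 1/2))\<^sup>2 / (pi * (Gamma (real n))\<^sup>2)"
    by (simp add: power_divide power_mult_distrib)
  also have "\<dots> \<le> 4 * (real n * (Gamma (real n))\<^sup>2) / (pi * (Gamma (real n))\<^sup>2)"
    using G pos by (intro divide_right_mono mult_left_mono) auto
  also have "\<dots> = (2 * sqrt (real n / pi))\<^sup>2"
    using pos by (simp add: power_mult_distrib)
  finally show ?thesis by (rule power2_le_imp_le) simp
qed

section \<open>The density of the hafnian\<close>

text \<open>
  The density of a centered circular Gaussian of variance \<open>minor_norm2 X \<eta> / C\<close>. Where \<open>minor_norm2\<close>
  vanishes (a null set) the kernel is the junk value \<open>0\<close>.
\<close>

definition haf_kernel :: "nat set \<Rightarrow> real \<Rightarrow> complex \<Rightarrow> (nat \<times> nat \<Rightarrow> complex) \<Rightarrow> real" where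
  "haf_kernel X C z \<eta> = C / (pi * minor_norm2 X \<eta>) * exp (- (C * (cmod z)\<^sup>2 / minor_norm2 X \<eta>))"

definition haf_density :: "nat set \<Rightarrow> real \<Rightarrow> complex \<Rightarrow> real" where
  "haf_density X C z = (LINT \<eta>|cgauss_vec (edges X). haf_kernel X C z \<eta>)"

lemma nn_integral_scaled_cgauss:
  fixes f :: "complex \<Rightarrow> ennreal"
  assumes [measurable]: "f \<in> borel_measurable borel" and v: "v > 0"
  shows "(\<integral>\<^sup>+z. f (of_real (sqrt v) * z) \<partial>cgauss) = (\<integral>\<^sup>+z. ennreal (1 / (pi * v) * exp (- ((cmod z)\<^sup>2 / v))) * f z \<partial>lborel)"
proof -
  have "(\<integral>\<^sup>+z. ennreal (1 / (pi * v) * exp (- ((cmod z)\<^sup>2 / v))) * f z \<partial>lborel)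
     = ennreal ((sqrt v)\<^sup>2) * (\<integral>\<^sup>+z. ennreal (1 / (pi * v) * exp (- ((cmod (of_real (sqrt v) * z))\<^sup>2 / v))) * f (of_real (sqrt v) * z) \<partial>lborel)"
    using v by (intro nn_integral_scale_complex) auto
  also have "\<dots> = (\<integral>\<^sup>+z. ennreal (exp (- (cmod z)\<^sup>2) / pi) * f (of_real (sqrt v) * z) \<partial>lborel)"
  proof -
    have "ennreal ((sqrt v)\<^sup>2) * (ennreal (1 / (pi * v) * exp (- ((cmod (of_real (sqrt v) * z))\<^sup>2 / v))) * w)
        = ennreal (exp (- (cmod z)\<^sup>2) / pi) * w" for z w
    proof -
      have "ennreal ((sqrt v)\<^sup>2) * ennreal (1 / (pi * v) * exp (- ((cmod (of_real (sqrt v) * z))\<^sup>2 / v)))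
          = ennreal ((sqrt v)\<^sup>2 * (1 / (pi * v) * exp (- ((cmod (of_real (sqrt v) * z))\<^sup>2 / v))))"
        using v by (intro ennreal_mult[symmetric]) auto
      also have "(sqrt v)\<^sup>2 * (1 / (pi * v) * exp (- ((cmod (of_real (sqrt v) * z))\<^sup>2 / v))) = exp (- (cmod z)\<^sup>2) / pi"
        using v by (simp add: norm_mult power_mult_distrib)
      finally show ?thesis by (simp only: mult.assoc[symmetric])
    qed
    then show ?thesis
      by (subst nn_integral_cmult[symmetric]) simp_all
  qed
  also have "\<dots> = (\<integral>\<^sup>+z. f (of_real (sqrt v) * z) \<partial>cgauss)"
    unfolding cgauss_def by (rule nn_integral_density[symmetric]) auto
  finally show ?thesis ..
qed

section \<open>Density of the hafnian on \<open>2 * m + 2\<close> vertices divided by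
  \<open>sqrt C\<close>\<close>

context
  fixes X :: "nat set" and C :: real and m :: nat
  assumes X: "finite X" "card X = Suc (2 * m)" and C: "C > 0"
begin

interpretation E: prob_space "cgauss_vec (edges X)" by (rule prob_space_cgauss_vec)

lemma measurable_minor_norm2_X [measurable]: "minor_norm2 X \<in> borel_measurable (cgauss_vec (edges X))"
  using X by (intro measurable_minor_norm2)

lemma measurable_haf_kernel [measurable]: "(\<lambda>(z, \<eta>). haf_kernel X C z \<eta>) \<in> borel_measurable (borel \<Otimes>\<^sub>M cgauss_vec (edges X))"
  unfolding haf_kernel_def by measurable

lemma measurable_haf_density [measurable]: "haf_density X C \<in> borel_measurable borel"
  unfolding haf_density_def by measurable

lemma haf_kernel_nonneg: "0 \<le> haf_kernel X C z \<eta>"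
  using C by (simp add: haf_kernel_def minor_norm2_nonneg)

lemma haf_kernel_antimono: "cmod z \<le> cmod w \<Longrightarrow> haf_kernel X C w \<eta> \<le> haf_kernel X C z \<eta>"
  unfolding haf_kernel_def using C
  by (intro mult_left_mono) (auto intro!: divide_right_mono mult_left_mono power_mono simp: minor_norm2_nonneg)

text \<open>At 0 the kernel is \<open>C / pi\<close> times the inverse of
  \<open>minor_norm2\<close>; the two differ only where \<open>minor_norm2\<close> vanishes, with
  junk value 0 against infinity. The rest is the inverse moment bound.\<close>

lemma nn_integral_haf_kernel_zero: "(\<integral>\<^sup>+\<eta>. ennreal (haf_kernel X C 0 \<eta>) \<partial>cgauss_vec (edges X)) \<le> ennreal (C / pi * (1 / (2 ^ m * fact m)))"
proof -
  have "ennreal (haf_kernel X C 0 \<eta>) \<le> ennreal (C / pi) * inverse (ennreal (minor_norm2 X \<eta>))" for \<eta>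
  proof (cases "minor_norm2 X \<eta> = 0")
    case False
    then have "minor_norm2 X \<eta> > 0" using minor_norm2_nonneg[of X \<eta>] by simp
    then show ?thesis using C
      by (simp add: haf_kernel_def inverse_ennreal ennreal_mult[symmetric] field_simps)
  qed (simp add: haf_kernel_def)
  then have "(\<integral>\<^sup>+\<eta>. ennreal (haf_kernel X C 0 \<eta>) \<partial>cgauss_vec (edges X)) \<le> (\<integral>\<^sup>+\<eta>. ennreal (C / pi) * inverse (ennreal (minor_norm2 X \<eta>)) \<partial>cgauss_vec (edges X))"
    by (intro nn_integral_mono)
  also have "\<dots> = ennreal (C / pi) * inverse_moment X"
    unfolding inverse_moment_def by (rule nn_integral_cmult) measurable
  also have "\<dots> \<le> ennreal (C / pi) * ennreal (1 / (2 ^ m * fact m))"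
    by (intro mult_left_mono inverse_moment_le X) auto
  also have "\<dots> = ennreal (C / pi * (1 / (2 ^ m * fact m)))"
    using C by (intro ennreal_mult[symmetric]) auto
  finally show ?thesis .
qed

text \<open>The kernel at 0 dominates, and its integral was just bounded.\<close>

lemma integrable_haf_kernel: "integrable (cgauss_vec (edges X)) (haf_kernel X C z)"
proof (rule Bochner_Integration.integrable_bound)
  have "(\<integral>\<^sup>+\<eta>. ennreal (haf_kernel X C 0 \<eta>) \<partial>cgauss_vec (edges X)) < \<infinity>"
    using nn_integral_haf_kernel_zero by (simp add: order.strict_trans1)
  then show "integrable (cgauss_vec (edges X)) (haf_kernel X C 0)"
    by (intro integrableI_nonneg) (auto simp: haf_kernel_nonneg)
  show "AE \<eta> in cgauss_vec (edges X). norm (haf_kernel X C z \<eta>) \<le> norm (haf_kernel X C 0 \<eta>)"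
    using haf_kernel_antimono[of 0 z] haf_kernel_nonneg by simp
qed measurable

lemma haf_density_nonneg: "0 \<le> haf_density X C z"
  unfolding haf_density_def by (intro integral_nonneg_AE) (simp add: haf_kernel_nonneg)

lemma haf_density_antimono: "cmod z \<le> cmod w \<Longrightarrow> haf_density X C w \<le> haf_density X C z"
  unfolding haf_density_def by (intro integral_mono integrable_haf_kernel haf_kernel_antimono)

lemma ennreal_haf_density: "ennreal (haf_density X C z) = (\<integral>\<^sup>+\<eta>. ennreal (haf_kernel X C z \<eta>) \<partial>cgauss_vec (edges X))"
  unfolding haf_density_def by (intro nn_integral_eq_integral[symmetric] integrable_haf_kernel) (simp add: haf_kernel_nonneg)

lemma haf_density_zero_le: "haf_density X C 0 \<le> C / pi * (1 / (2 ^ m * fact m))"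
  using nn_integral_haf_kernel_zero C unfolding ennreal_haf_density[symmetric] by (simp add: ennreal_le_iff)

text \<open>Dominated convergence with the kernel at 0. The limit is needed because a single point
  is a null set, invisible to the essential supremum.\<close>

lemma haf_density_tendsto: "(\<lambda>k. haf_density X C (of_real (1 / real (Suc k)))) \<longlonglongrightarrow> haf_density X C 0"
  unfolding haf_density_def
proof (rule integral_dominated_convergence[where w="haf_kernel X C 0"])
  show "AE \<eta> in cgauss_vec (edges X). (\<lambda>k. haf_kernel X C (of_real (1 / real (Suc k))) \<eta>) \<longlonglongrightarrow> haf_kernel X C 0 \<eta>"
  proof (intro always_eventually allI)
    fix \<eta>
    have lim: "(\<lambda>k. haf_kernel X C (zs k) \<eta>) \<longlonglongrightarrow> haf_kernel X C 0 \<eta>" if "zs \<longlonglongrightarrow> 0" for zs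
      unfolding haf_kernel_def divide_inverse by (auto intro!: tendsto_eq_intros that)
    have "(\<lambda>k. complex_of_real (1 / real (Suc k))) \<longlonglongrightarrow> of_real 0"
      by (intro tendsto_of_real) real_asymp
    then show "(\<lambda>k. haf_kernel X C (of_real (1 / real (Suc k))) \<eta>) \<longlonglongrightarrow> haf_kernel X C 0 \<eta>"
      by (intro lim) simp
  qed
  show "AE \<eta> in cgauss_vec (edges X). norm (haf_kernel X C (of_real (1 / real (Suc k))) \<eta>) \<le> haf_kernel X C 0 \<eta>" for k
    using haf_kernel_antimono[of 0 "of_real (1 / real (Suc k))"] haf_kernel_nonneg by simp
qed (auto intro: integrable_haf_kernel)

text \<open>Monotonicity gives the upper bound. Conversely, a ball of radius \<open>r\<close> around
  0 has positive measure, so it contains a point with value at most \<open>c\<close>; monotonicity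
  then bounds the value at radius \<open>r\<close>, and \<open>r\<close> tends to 0.\<close>

lemma esssup_haf_density: "esssup lborel (\<lambda>z. ereal \<bar>haf_density X C z\<bar>) = ereal (haf_density X C 0)"
proof (rule antisym)
  show "esssup lborel (\<lambda>z. ereal \<bar>haf_density X C z\<bar>) \<le> ereal (haf_density X C 0)"
    by (intro esssup_I) (auto simp: haf_density_nonneg haf_density_antimono)
  define c where "c = esssup lborel (\<lambda>z. ereal \<bar>haf_density X C z\<bar>)"
  have le: "ereal (haf_density X C (of_real (1 / real (Suc k)))) \<le> c" for k
  proof -
    define r where "r = 1 / real (Suc k)"
    have r: "r > 0" by (simp add: r_def)
    have "\<exists>z\<in>ball 0 r. ereal \<bar>haf_density X C z\<bar> \<le> c"
    proof (rule ccontr)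
      assume "\<not> ?thesis"
      then have no: "\<not> ereal \<bar>haf_density X C z\<bar> \<le> c" if "z \<in> ball 0 r" for z
        using that by blast
      have "AE z in lborel. ereal \<bar>haf_density X C z\<bar> \<le> c"
        unfolding c_def by (rule esssup_AE)
      then have "AE z in lborel. z \<notin> ball (0::complex) r"
        by (rule eventually_mono) (use no in blast)
      then have "emeasure lborel (ball (0::complex) r) = 0"
        by (subst (asm) AE_iff_measurable[of "ball 0 r"]) auto
      then show False using r by (simp add: emeasure_ball unit_ball_vol_2)
    qed
    then obtain z where "cmod z < r" "ereal \<bar>haf_density X C z\<bar> \<le> c" by auto
    moreover have "haf_density X C (of_real r) \<le> \<bar>haf_density X C z\<bar>"
      using \<open>cmod z < r\<close> r haf_density_nonneg by (simp add: haf_density_antimono)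
    ultimately show ?thesis unfolding r_def[symmetric] by (meson ereal_less_eq(3) order_trans)
  qed
  have "(\<lambda>k. ereal (haf_density X C (of_real (1 / real (Suc k))))) \<longlonglongrightarrow> ereal (haf_density X C 0)"
    using haf_density_tendsto by simp
  then show "ereal (haf_density X C 0) \<le> c"
    by (rule LIMSEQ_le_const2) (use le in auto)
qed

text \<open>A finite inverse moment excludes zeros outside a null set.\<close>

lemma AE_minor_norm2_pos: "AE \<eta> in cgauss_vec (edges X). minor_norm2 X \<eta> > 0"
proof -
  have "inverse_moment X \<noteq> \<infinity>" using inverse_moment_le[OF X] by (auto simp: top_unique)
  then have "AE \<eta> in cgauss_vec (edges X). inverse (ennreal (minor_norm2 X \<eta>)) \<noteq> \<infinity>"
    unfolding inverse_moment_def by (intro nn_integral_noteq_infinite) auto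
  then show ?thesis
  proof (rule eventually_mono)
    fix \<eta> assume "inverse (ennreal (minor_norm2 X \<eta>)) \<noteq> \<infinity>"
    then have "minor_norm2 X \<eta> \<noteq> 0" by auto
    then show "minor_norm2 X \<eta> > 0" using minor_norm2_nonneg[of X \<eta>] by simp
  qed
qed

text \<open>Given the matrix on \<open>X\<close>, the hafnian is a linear form in an independent
  Gaussian row, hence Gaussian with variance \<open>minor_norm2\<close>; Fubini then mixes these
  densities.\<close>

lemma distr_haf:
  assumes c: "c \<notin> X"
  shows "distr (cgauss_vec (edges (insert c X))) lborel (\<lambda>w. haf (insert c X) w / of_real (sqrt C)) = density lborel (\<lambda>z. ennreal (haf_density X C z))"
proof (rule measure_eqI)
  fix A assume "A \<in> sets (distr (cgauss_vec (edges (insert c X))) lborel (\<lambda>w. haf (insert c X) w / of_real (sqrt C)))"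
  then have A [measurable]: "A \<in> sets borel" by simp
  interpret P: pair_prob_space "cgauss_vec X" "cgauss_vec (edges X)" by (rule prob_space_cgauss_vec_pair)
  interpret Q: pair_sigma_finite lborel "cgauss_vec (edges X)" ..
  note [measurable] = measurable_add_row[OF c]
  have [measurable]: "haf (insert c X) \<in> borel_measurable (cgauss_vec (edges (insert c X)))"
    using X by (intro measurable_haf) auto
  define f :: "complex \<Rightarrow> ennreal" where "f = (\<lambda>z. indicator A (z / of_real (sqrt C)))"
  have [measurable]: "f \<in> borel_measurable borel" unfolding f_def by measurable
  have "emeasure (distr (cgauss_vec (edges (insert c X))) lborel (\<lambda>w. haf (insert c X) w / of_real (sqrt C))) A
     = (\<integral>\<^sup>+w. f (haf (insert c X) w) \<partial>cgauss_vec (edges (insert c X)))"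
    unfolding f_def by (simp add: nn_integral_distr flip: nn_integral_indicator)
  also have "\<dots> = (\<integral>\<^sup>+z. f (haf (insert c X) (add_row c X z)) \<partial>(cgauss_vec X \<Otimes>\<^sub>M cgauss_vec (edges X)))"
    by (subst distr_add_row[OF X(1) c, symmetric], rule nn_integral_distr) auto
  also have "\<dots> = (\<integral>\<^sup>+\<eta>. \<integral>\<^sup>+x. f (haf (insert c X) (add_row c X (x, \<eta>))) \<partial>cgauss_vec X \<partial>cgauss_vec (edges X))"
    by (rule P.nn_integral_snd[symmetric]) measurable
  also have "\<dots> = (\<integral>\<^sup>+\<eta>. \<integral>\<^sup>+x. f (\<Sum>b\<in>X. haf (X - {b}) \<eta> * x b) \<partial>cgauss_vec X \<partial>cgauss_vec (edges X))"
    by (simp add: haf_add_row_insert[OF X(1) c] mult.commute)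
  also have "\<dots> = (\<integral>\<^sup>+\<eta>. \<integral>\<^sup>+z. f (of_real (sqrt (minor_norm2 X \<eta>)) * z) \<partial>cgauss \<partial>cgauss_vec (edges X))"
    unfolding minor_norm2_def by (intro nn_integral_cong nn_integral_lincomb_cgauss_vec X) measurable
  \<comment> \<open>The density formula requires positive conditional variance, so the integrands
    agree only almost everywhere.\<close>
  also have "\<dots> = (\<integral>\<^sup>+\<eta>. \<integral>\<^sup>+z. ennreal (haf_kernel X C z \<eta>) * indicator A z \<partial>lborel \<partial>cgauss_vec (edges X))"
  proof (rule nn_integral_cong_AE, rule eventually_mono[OF AE_minor_norm2_pos])
    fix \<eta> assume S: "minor_norm2 X \<eta> > 0"
    have "f (of_real (sqrt (minor_norm2 X \<eta>)) * z) = indicator A (of_real (sqrt (minor_norm2 X \<eta> / C)) * z)" for z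
      using C by (simp add: f_def real_sqrt_divide)
    then have "(\<integral>\<^sup>+z. f (of_real (sqrt (minor_norm2 X \<eta>)) * z) \<partial>cgauss) = (\<integral>\<^sup>+z. indicator A (of_real (sqrt (minor_norm2 X \<eta> / C)) * z) \<partial>cgauss)"
      by simp
    also have "\<dots> = (\<integral>\<^sup>+z. ennreal (1 / (pi * (minor_norm2 X \<eta> / C)) * exp (- ((cmod z)\<^sup>2 / (minor_norm2 X \<eta> / C)))) * indicator A z \<partial>lborel)"
      using S C by (intro nn_integral_scaled_cgauss) auto
    also have "\<dots> = (\<integral>\<^sup>+z. ennreal (haf_kernel X C z \<eta>) * indicator A z \<partial>lborel)"
      by (simp add: haf_kernel_def mult.commute)
    finally show "(\<integral>\<^sup>+z. f (of_real (sqrt (minor_norm2 X \<eta>)) * z) \<partial>cgauss) = (\<integral>\<^sup>+z. ennreal (haf_kernel X C z \<eta>) * indicator A z \<partial>lborel)" .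
  qed
  also have "\<dots> = (\<integral>\<^sup>+z. \<integral>\<^sup>+\<eta>. ennreal (haf_kernel X C z \<eta>) * indicator A z \<partial>cgauss_vec (edges X) \<partial>lborel)"
    by (rule Q.Fubini') measurable
  also have "\<dots> = (\<integral>\<^sup>+z. ennreal (haf_density X C z) * indicator A z \<partial>lborel)"
    unfolding ennreal_haf_density by (intro nn_integral_cong nn_integral_multc) measurable
  also have "\<dots> = emeasure (density lborel (\<lambda>z. ennreal (haf_density X C z))) A"
    by (subst emeasure_density) auto
  finally show "emeasure (distr (cgauss_vec (edges (insert c X))) lborel (\<lambda>w. haf (insert c X) w / of_real (sqrt C))) A
    = emeasure (density lborel (\<lambda>z. ennreal (haf_density X C z))) A" .
qed simp

end

section \<open>Law of the entries above the diagonal\<close>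

text \<open>Independence means that the joint law is the product of the marginals, each of which is
  \<open>cgauss\<close>.\<close>

lemma distr_gaussian_symmetric_matrix:
  assumes M: "prob_space M" and N: "N \<ge> 2" and G: "gaussian_symmetric_matrix M N G"
  defines "g \<equiv> \<lambda>\<omega>. \<lambda>e\<in>edges {1..N}. G \<omega> (fst e) (snd e)"
  shows "g \<in> measurable M (cgauss_vec (edges {1..N}))" "distr M (cgauss_vec (edges {1..N})) g = cgauss_vec (edges {1..N})"
proof -
  interpret prob_space M by fact
  have E: "{(i, j). 1 \<le> i \<and> i < j \<and> j \<le> N} = edges {1..N}" by (auto simp: edges_def)
  have iv: "indep_vars (\<lambda>_. borel) (\<lambda>e \<omega>. G \<omega> (fst e) (snd e)) (edges {1..N})"
    using G unfolding gaussian_symmetric_matrix_def E by (simp add: case_prod_beta')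
  have scn: "std_complex_normal M (\<lambda>\<omega>. G \<omega> (fst e) (snd e))" if "e \<in> edges {1..N}" for e
    using G that by (auto simp: gaussian_symmetric_matrix_def edges_def)
  have rv: "random_variable borel (\<lambda>\<omega>. G \<omega> (fst e) (snd e))" if "e \<in> edges {1..N}" for e
    using iv that by (auto simp: indep_vars_def)
  \<comment> \<open>The description of independence by the joint law is applied to a nonempty index
    set; this is where \<open>N \<ge> 2\<close> enters.\<close>
  have "(1, 2) \<in> edges {1..N}" using N by (auto simp: edges_def)
  then have ne: "edges {1..N} \<noteq> {}" by blast
  have s: "sets (cgauss_vec (edges {1..N})) = sets (\<Pi>\<^sub>M i\<in>edges {1..N}. borel)"
    by (intro sets_PiM_cong) auto
  show "g \<in> measurable M (cgauss_vec (edges {1..N}))"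
    unfolding measurable_cong_sets[OF refl s] g_def using rv by (intro measurable_restrict)
  have "distr M (cgauss_vec (edges {1..N})) g = distr M (\<Pi>\<^sub>M i\<in>edges {1..N}. borel) g"
    by (rule distr_cong[OF refl s refl])
  also have "\<dots> = (\<Pi>\<^sub>M e\<in>edges {1..N}. distr M borel (\<lambda>\<omega>. G \<omega> (fst e) (snd e)))"
    unfolding g_def
    by (rule iffD1[OF indep_vars_iff_distr_eq_PiM'[OF ne, where M'="\<lambda>_. borel" and X="\<lambda>e \<omega>. G \<omega> (fst e) (snd e)"]])
      (use iv rv in auto)
  also have "\<dots> = cgauss_vec (edges {1..N})"
    by (intro PiM_cong refl distr_eq_cgaussI scn M)
  finally show "distr M (cgauss_vec (edges {1..N})) g = cgauss_vec (edges {1..N})" .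
qed

theorem theorem1p1:
  fixes M :: "'a measure" and n :: nat
    and G :: "'a \<Rightarrow> nat \<Rightarrow> nat \<Rightarrow> complex"
    and W :: "'a \<Rightarrow> complex"
  assumes "prob_space M"
    and "n \<ge> 1"
    and "gaussian_symmetric_matrix M (2 * n) G"
    and W_def: "W = (\<lambda>\<omega>. normalized_hafnian n (G \<omega>))"
  shows "(\<exists>p :: complex \<Rightarrow> real.
            (\<forall>z. 0 \<le> p z) \<and>
            distributed M lborel W (\<lambda>z. ennreal (p z)) \<and>
            (\<forall>z w. cmod z = cmod w \<longrightarrow> p z = p w) \<and>
            (\<forall>z w. cmod z \<le> cmod w \<longrightarrow> p w \<le> p z) \<and>
            esssup lborel (\<lambda>z. ereal \<bar>p z\<bar>) = ereal (p 0) \<and>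
            p 0 \<le> 1 / pi * B n)
       \<and> B n = 2 * real n / 4 ^ n * real ((2 * n) choose n)
       \<and> (\<forall>z :: complex. \<forall>\<epsilon> > 0.
            measure M {\<omega> \<in> space M. cmod (W \<omega> - z) \<le> \<epsilon>} \<le> B n * \<epsilon>\<^sup>2 \<and>
            B n * \<epsilon>\<^sup>2 \<le> 2 * sqrt (real n / pi) * \<epsilon>\<^sup>2)"
proof -
  interpret prob_space M by fact
  define C where "C = real (odd_double_fact n)"
  \<comment> \<open>Vertex 1 carries the expanded row; the remaining \<open>2 * n - 1\<close>
    vertices correspond to \<open>m = n - 1\<close>.\<close>
  define X where "X = {2..2 * n}"
  define V where "V = {1..2 * n}"
  define g where "g = (\<lambda>\<omega>. \<lambda>e\<in>edges V. G \<omega> (fst e) (snd e))"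
  have C: "C > 0" by (simp add: C_def odd_double_fact_pos)
  have X: "finite X" "card X = Suc (2 * (n - 1))" using \<open>n \<ge> 1\<close> by (auto simp: X_def)
  have V: "V = insert 1 X" and c: "1 \<notin> X" using \<open>n \<ge> 1\<close> by (auto simp: X_def V_def)
  note dens = X C
  define p where "p = haf_density X C"
  note [measurable] = measurable_haf_density[OF dens, folded p_def]
  have g: "g \<in> measurable M (cgauss_vec (edges V))" "distr M (cgauss_vec (edges V)) g = cgauss_vec (edges V)"
    unfolding g_def V_def using distr_gaussian_symmetric_matrix[OF assms(1) _ assms(3)] \<open>n \<ge> 1\<close> by auto
  note [measurable] = g(1)
  have [measurable]: "haf V \<in> borel_measurable (cgauss_vec (edges V))"
    by (intro measurable_haf) (auto simp: V_def)
  have "hafnian n (G \<omega>) = haf V (g \<omega>)" for \<omega>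
  proof -
    have "hafnian n (G \<omega>) = haf V (\<lambda>e. G \<omega> (fst e) (snd e))"
      by (simp add: hafnian_def haf_def V_def)
    \<comment> \<open>Matchings read only increasing pairs, so the restriction to
      \<open>edges V\<close> is harmless and the diagonal never enters.\<close>
    also have "\<dots> = haf V (g \<omega>)"
      by (rule haf_cong) (auto simp: g_def V_def)
    finally show ?thesis .
  qed
  then have W: "W = (\<lambda>\<omega>. haf V (g \<omega>) / of_real (sqrt C))"
    by (simp add: W_def normalized_hafnian_def C_def)
  have [measurable]: "W \<in> borel_measurable M" unfolding W by measurable
  have "distr M lborel W = distr (distr M (cgauss_vec (edges V)) g) lborel (\<lambda>w. haf V w / of_real (sqrt C))"
    unfolding W by (subst distr_distr) (auto simp: o_def)
  also have "\<dots> = density lborel (\<lambda>z. ennreal (p z))"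
    unfolding g(2) unfolding V p_def by (rule distr_haf[OF dens c])
  finally have distr: "distr M lborel W = density lborel (\<lambda>z. ennreal (p z))" .
  \<comment> \<open>With \<open>C\<close> the double factorial, the bound on the density at 0 is
    exactly \<open>B n / pi\<close>.\<close>
  have p0: "p 0 \<le> 1 / pi * B n"
    using haf_density_zero_le[OF dens] by (simp add: p_def B_def C_def)
  have anti: "p w \<le> p z" if "cmod z \<le> cmod w" for z w
    using haf_density_antimono[OF dens that] by (simp add: p_def)
  have nonneg: "0 \<le> p z" for z
    using haf_density_nonneg[OF dens] by (simp add: p_def)
  have "measure M {\<omega> \<in> space M. cmod (W \<omega> - z) \<le> \<epsilon>} \<le> B n * \<epsilon>\<^sup>2" if \<epsilon>: "\<epsilon> > 0" for z \<epsilon>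
  proof -
    have "emeasure M {\<omega> \<in> space M. cmod (W \<omega> - z) \<le> \<epsilon>} = emeasure (distr M lborel W) (cball z \<epsilon>)"
      by (subst emeasure_distr) (auto intro!: arg_cong[where f="emeasure M"] simp: dist_norm norm_minus_commute)
    also have "\<dots> = (\<integral>\<^sup>+w. ennreal (p w) * indicator (cball z \<epsilon>) w \<partial>lborel)"
      unfolding distr by (rule emeasure_density) auto
    \<comment> \<open>The density is bounded by its value at 0, and the disc has area
      \<open>pi * \<epsilon>\<^sup>2\<close>.\<close>
    also have "\<dots> \<le> (\<integral>\<^sup>+w. ennreal (1 / pi * B n) * indicator (cball z \<epsilon>) w \<partial>lborel)"
      using anti[of 0] p0 by (intro nn_integral_mono mult_right_mono ennreal_leI) (auto intro: order_trans)
    also have "\<dots> = ennreal (1 / pi * B n) * ennreal (pi * \<epsilon>\<^sup>2)"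
      using \<epsilon> by (simp add: nn_integral_cmult_indicator emeasure_cball unit_ball_vol_2)
    also have "\<dots> = ennreal (1 / pi * B n * (pi * \<epsilon>\<^sup>2))"
      using \<epsilon> by (intro ennreal_mult[symmetric]) (auto simp: B_def)
    also have "1 / pi * B n * (pi * \<epsilon>\<^sup>2) = B n * \<epsilon>\<^sup>2" by simp
    finally show ?thesis
      unfolding emeasure_eq_measure by (subst (asm) ennreal_le_iff) (auto simp: B_def)
  qed
  moreover have "B n * \<epsilon>\<^sup>2 \<le> 2 * sqrt (real n / pi) * \<epsilon>\<^sup>2" for \<epsilon>
    using B_le_sqrt[OF \<open>n \<ge> 1\<close>] by (rule mult_right_mono) simp
  moreover have "distributed M lborel W (\<lambda>z. ennreal (p z))"
    unfolding distributed_def using distr by auto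
  moreover have "esssup lborel (\<lambda>z. ereal \<bar>p z\<bar>) = ereal (p 0)"
    unfolding p_def by (rule esssup_haf_density[OF dens])
  moreover have "p z = p w" if "cmod z = cmod w" for z w
    using anti[of z w] anti[of w z] that by simp
  ultimately show ?thesis
    using nonneg anti p0 B_eq_binomial[OF \<open>n \<ge> 1\<close>] by (intro conjI exI[of _ p]) blast+
qed

end
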